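(* Let $\delta>0$, let $K>\delta$ and let $a\geq \frac{K^2}{K-\delta}$. Then the system $$e_t(x,t)=a\,e_{xx}(x,t)-K\,e(\pi,t),\qquad x\in[0,2\pi],\ t\geq 0,$$ with periodic boundary conditions $$e(0,t)=e(2\pi,t),\qquad e_x(0,t)=e_x(2\pi,t),$$ is exponentially stable with decay rate $\delta$ in the $\mathcal H^1$-norm: there exists $C>0$ such that every solution with $e(\cdot,0)\in X$ satisfies $$\|e(\cdot,t)\|_{\mathcal H^1}\leq C e^{-\delta t}\,\|e(\cdot,0)\|_{\mathcal H^1}\qquad\text{for all } t\geq 0 .$$
   Context: The unknown $e=e(x,t)\in\mathbb R^3$, $x\in[0,2\pi]$, $t\ge 0$, is the error $e(x,t)=z(x,t)-\gamma(x)$ between the agents' continuum position $z$ and a closed $\mathcal C^2$ curve $\gamma:[0,2\pi]\to\mathbb R^3$; its components are decoupled, each satisfying the same scalar equation. The subscripts $t,x$ denote partial derivatives, and $a>0$, $K>0$ are control gains. $\mathcal L_2(0,2\pi)$ is the space of square integrable functions with norm $\|\cdot\|$. $\mathcal H^1(0,2\pi)$ is the Sobolev space of absolutely continuous functions with derivative in $\mathcal L_2(0,2\pi)$, with norm $\|w\|_{\mathcal H^1}^2=\|w\|^2+\|w_x\|^2$ (summed over components for $\mathbb R^3$-valued functions). $\mathcal H^2(0,2\pi)$ is the Sobolev space of functions $w$ with $w_x$ absolutely continuous and $w_{xx}\in\mathcal L_2(0,2\pi)$. $X=\{w\in\mathcal H^1(0,2\pi)\mid w(0)=w(2\pi)\}$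 (componentwise). Solutions are the unique strong solutions with initial condition $e(\cdot,0)\in X$, in the usual sense: $e\in C([0,T];X)\cap L_2(0,T;\mathcal H^2(0,2\pi))$ and $e_t\in L_2(0,T;\mathcal L_2(0,2\pi))$ for each $T>0$, with the equation and the boundary conditions holding for almost all $t$. *)

theory Defs
  imports "HOL-Analysis.Analysis"
begin

text \<open>
  The \<open>\<epsilon>\<close>-\<open>\<delta>\<close> definition of absolute continuity on \<open>[l, r]\<close>, for functions into a set
  with distance function \<open>d\<close>. A finite family of non-overlapping subintervals is
  encoded as the set of its endpoint pairs. The library constant
  \<open>absolutely_continuous\<close> is about measures and is unrelated.
\<close>

definition abs_cont_on :: "('b \<Rightarrow> 'b \<Rightarrow> real) \<Rightarrow> real \<Rightarrow> real \<Rightarrow> (real \<Rightarrow> 'b) \<Rightarrow> bool" where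
  "abs_cont_on d l r f \<longleftrightarrow>
    (\<forall>\<epsilon>>0. \<exists>\<delta>>0. \<forall>P. finite P \<and>
        (\<forall>(u, v)\<in>P. l \<le> u \<and> u \<le> v \<and> v \<le> r) \<and>
        disjoint_family_on (\<lambda>(u, v). {u<..<v}) P \<and>
        (\<Sum>(u, v)\<in>P. v - u) < \<delta>
      \<longrightarrow> (\<Sum>(u, v)\<in>P. d (f u) (f v)) < \<epsilon>)"

abbreviation Omega :: "real measure" where
  "Omega \<equiv> lebesgue_on {0..2*pi}"

definition L2 :: "(real \<Rightarrow> 'v::euclidean_space) set" where
  "L2 = {w. w \<in> borel_measurable Omega \<and> integrable Omega (\<lambda>x. (norm (w x))\<^sup>2)}"

definition L2_norm :: "(real \<Rightarrow> 'v::euclidean_space) \<Rightarrow> real" where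
  "L2_norm w = sqrt (LINT x|Omega. (norm (w x))\<^sup>2)"

text \<open>
  The derivative relative to \<open>[0, 2\<pi>]\<close>, hence one-sided at the endpoints. Where \<open>w\<close> is
  not differentiable, \<open>Dx w x\<close> has no meaning; only almost every \<open>x\<close> matters, except
  for \<open>w\<close> in \<open>H2\<close>, which is differentiable on all of \<open>[0, 2\<pi>]\<close>.
\<close>

definition Dx :: "(real \<Rightarrow> 'v::euclidean_space) \<Rightarrow> real \<Rightarrow> 'v" where
  "Dx w x = vector_derivative w (at x within {0..2*pi})"

text \<open>
  Absolutely continuous functions are differentiable almost everywhere, so the second
  conjunct below is redundant (Lebesgue); it records that \<open>Dx w\<close> is meaningful.
\<close>

definition H1 :: "(real \<Rightarrow> 'v::euclidean_space) set" where
  "H1 = {w. abs_cont_on dist 0 (2*pi) w \<and>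
            (AE x in Omega. w differentiable (at x within {0..2*pi})) \<and>
            Dx w \<in> L2}"

definition H1_norm :: "(real \<Rightarrow> 'v::euclidean_space) \<Rightarrow> real" where
  "H1_norm w = sqrt ((L2_norm w)\<^sup>2 + (L2_norm (Dx w))\<^sup>2)"

definition H2 :: "(real \<Rightarrow> 'v::euclidean_space) set" where
  "H2 = {w. (\<forall>x\<in>{0..2*pi}. w differentiable (at x within {0..2*pi})) \<and> Dx w \<in> H1}"

definition X_space :: "(real \<Rightarrow> 'v::euclidean_space) set" where
  "X_space = {w \<in> H1. w 0 = w (2*pi)}"

text \<open>
  From here on \<open>f t x\<close> is the value at time \<open>t\<close> and position \<open>x\<close>, so \<open>f t\<close> is a function
  of the space variable.
\<close>

definition C_X :: "real \<Rightarrow> (real \<Rightarrow> real \<Rightarrow> 'v::euclidean_space) set" where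
  "C_X T = {f. (\<forall>t\<in>{0..T}. f t \<in> X_space) \<and>
     (\<forall>t\<in>{0..T}. ((\<lambda>s. H1_norm (\<lambda>x. f s x - f t x)) \<longlongrightarrow> 0) (at t within {0..T}))}"

text \<open>
  The Bochner space \<open>L\<^sub>2(0,T; L\<^sub>2(0,2\<pi>))\<close> is identified with \<open>L\<^sub>2((0,T) \<times> (0,2\<pi>))\<close>. As its
  elements are classes of functions, only some representative \<open>g\<close> has to be jointly
  measurable. A function lies in \<open>L\<^sub>2(0,T; H\<^sup>2)\<close> iff its values lie in \<open>H\<^sup>2\<close> for almost all
  times and it is in \<open>L\<^sub>2(0,T; L\<^sub>2)\<close> together with its first two space derivatives.
\<close>

definition L2_L2 :: "real \<Rightarrow> (real \<Rightarrow> real \<Rightarrow> 'v::euclidean_space) set" where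
  "L2_L2 T = {f. \<exists>g.
     (\<lambda>(t, x). g t x) \<in> borel_measurable (lebesgue_on {0..T} \<Otimes>\<^sub>M Omega) \<and>
     integrable (lebesgue_on {0..T} \<Otimes>\<^sub>M Omega) (\<lambda>(t, x). (norm (g t x))\<^sup>2) \<and>
     (AE t in lebesgue_on {0..T}. AE x in Omega. f t x = g t x)}"

definition L2_H2 :: "real \<Rightarrow> (real \<Rightarrow> real \<Rightarrow> 'v::euclidean_space) set" where
  "L2_H2 T = {f. (AE t in lebesgue_on {0..T}. f t \<in> H2) \<and>
     f \<in> L2_L2 T \<and> (\<lambda>t. Dx (f t)) \<in> L2_L2 T \<and> (\<lambda>t. Dx (Dx (f t))) \<in> L2_L2 T}"

text \<open>
  The time derivative is that of an \<open>L\<^sub>2(0,2\<pi>)\<close>-valued function: \<open>f\<close> is absolutely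
  continuous into \<open>L\<^sub>2(0,2\<pi>)\<close> and its difference quotients converge in \<open>L\<^sub>2(0,2\<pi>)\<close> to
  \<open>ft t\<close> for almost every \<open>t\<close>.
\<close>

definition has_L2_time_derivative ::
    "real \<Rightarrow> (real \<Rightarrow> real \<Rightarrow> 'v::euclidean_space) \<Rightarrow> (real \<Rightarrow> real \<Rightarrow> 'v) \<Rightarrow> bool" where
  "has_L2_time_derivative T f ft \<longleftrightarrow>
     abs_cont_on (\<lambda>v w. L2_norm (\<lambda>x. v x - w x)) 0 T f \<and>
     (AE t in lebesgue_on {0..T}.
        ((\<lambda>s. L2_norm (\<lambda>x. (f s x - f t x) /\<^sub>R (s - t) - ft t x)) \<longlongrightarrow> 0)
          (at t within {0..T}))"

definition strong_solution ::
    "real \<Rightarrow> real \<Rightarrow> (real \<Rightarrow> real \<Rightarrow> 'v::euclidean_space) \<Rightarrow> bool" where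
  "strong_solution a K e \<longleftrightarrow>
    (\<exists>et.
      (\<forall>T>0. e \<in> C_X T \<and> e \<in> L2_H2 T \<and> et \<in> L2_L2 T \<and> has_L2_time_derivative T e et) \<and>
      (AE t in lebesgue_on {0..}.
        (AE x in Omega. et t x = a *\<^sub>R Dx (Dx (e t)) x - K *\<^sub>R e t pi) \<and>
        e t 0 = e t (2*pi) \<and> Dx (e t) 0 = Dx (e t) (2*pi)))"

end

theory Submission
  imports Defs
begin

text \<open>
  The term \<open>K * e(\<pi>, t)\<close> does not depend on \<open>x\<close>, so it only drives the mean of \<open>e\<close>: every other
  Fourier coefficient satisfies \<open>c' = - a * k\<^sup>2 * c\<close>, as for the heat equation. Hence
  \<open>\<parallel>e\<^sub>x\<parallel>\<close> decays like \<open>exp (- a * t)\<close>. The mean \<open>m\<close> satisfies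
  \<open>m' = - K * m + K * (m - e(\<pi>, t))\<close>, where the last term is bounded by \<open>\<parallel>e\<^sub>x\<parallel>\<close>. Since the hypothesis
  gives \<open>a > K > \<delta>\<close>, the mean decays like \<open>exp (- K * t)\<close>, and \<open>m\<close> and \<open>\<parallel>e\<^sub>x\<parallel>\<close> control the
  \<open>H\<^sup>1\<close> norm.
\<close>

section \<open>Absolutely continuous functions\<close>

text \<open>The obstacle is regularity. An energy estimate would differentiate the squared norm of
  e_x in time, but time differentiability is given only in \<open>L2\<close>, and second space
  derivatives exist only for almost every time. A Fourier coefficient, by contrast, is a bounded
  functional on \<open>L2\<close>, hence an absolutely continuous function of time with a derivative
  almost everywhere; an integrating factor solves its equation once the fundamental theorem of
  calculus holds for absolute continuity in the \<epsilon>-\<delta> sense. The way back from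
  coefficients to norms needs no Fourier series: testing against trigonometric polynomials, dense by
  Stone-Weierstrass on the circle, is enough. The test needs a continuous periodic e_x, available
  only for almost every time; the remaining times are reached through continuity of the solution
  into \<open>X_space\<close>.\<close>

lemma disjoint_intervals_length_le:
  fixes P :: "(real \<times> real) set"
  assumes "finite P" and le: "\<And>u v. (u, v) \<in> P \<Longrightarrow> u \<le> v"
    and disj: "disjoint_family_on (\<lambda>(u, v). {u<..<v}) P"
    and U: "U \<in> lmeasurable" and sub: "\<And>u v. (u, v) \<in> P \<Longrightarrow> {u<..<v} \<subseteq> U"
  shows "(\<Sum>(u, v)\<in>P. v - u) \<le> measure lebesgue U"
proof -
  have "(\<Sum>(u, v)\<in>P. v - u) = (\<Sum>p\<in>P. measure lebesgue ((\<lambda>(u, v). {u<..<v}) p))"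
    using le by (intro sum.cong) (auto simp: measure_completion)
  also have "\<dots> = measure lebesgue (\<Union>p\<in>P. (\<lambda>(u, v). {u<..<v}) p)"
    using assms(1) disj by (intro measure_finite_Union[symmetric]) (auto simp: emeasure_lborel_Ioo le)
  also have "\<dots> \<le> measure lebesgue U"
    using sub U by (intro measure_mono_fmeasurable sets.finite_UN) (use assms(1) in auto)
  finally show ?thesis .
qed

text \<open>
  Tagged intervals whose tag lies in the exceptional null set lie in an open set of small
  measure, so absolute continuity controls their contribution to the Riemann sum.
\<close>

lemma abs_cont_fundamental_theorem:
  fixes f :: "real \<Rightarrow> 'a::banach"
  assumes ac: "abs_cont_on dist l r f" and "l \<le> r" and N: "negligible N"
    and vd: "\<And>x. x \<in> {l..r} - N \<Longrightarrow> (f has_vector_derivative f' x) (at x within {l..r})"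
  shows "(f' has_integral (f r - f l)) {l..r}"
proof (cases "l = r")
  case True
  then show ?thesis by auto
next
  case False
  with \<open>l \<le> r\<close> have "l < r" by simp
  \<comment> \<open>The values of \<open>f'\<close> on \<open>N\<close> are arbitrary. With 0 there,
    a tag in \<open>N\<close> contributes only the increment of \<open>f\<close>; a spike on the
    negligible set restores \<open>f'\<close> at the end.\<close>
  define g where "g x = (if x \<in> N then 0 else f' x)" for x
  have "(g has_integral (f r - f l)) {l..r}"
    unfolding has_integral_factor_content_real
  proof (intro allI impI)
    fix e :: real
    assume "e > 0"
    \<comment> \<open>The total error allowed is \<open>e * (r - l)\<close>: one half is kept for
      the tags in \<open>N\<close>, the other for the tags where \<open>f\<close> has a
      derivative.\<close>
    then have "e * (r - l) / 2 > 0" using \<open>l < r\<close> by simp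
    then obtain \<delta> where "\<delta> > 0" and \<delta>: "\<And>P. finite P \<Longrightarrow>
        (\<forall>(u, v)\<in>P. l \<le> u \<and> u \<le> v \<and> v \<le> r) \<Longrightarrow>
        disjoint_family_on (\<lambda>(u, v). {u<..<v}) P \<Longrightarrow>
        (\<Sum>(u, v)\<in>P. v - u) < \<delta> \<Longrightarrow> (\<Sum>(u, v)\<in>P. dist (f u) (f v)) < e * (r - l) / 2"
      using ac unfolding abs_cont_on_def by meson
    have Nl: "N \<in> null_sets lebesgue" using N by (simp add: negligible_iff_null_sets)
    then obtain U where U: "open U" "N \<subseteq> U" "U - N \<in> lmeasurable" "emeasure lebesgue (U - N) < ennreal \<delta>"
      using sets_lebesgue_outer_open[of N \<delta>] \<open>\<delta> > 0\<close> by (metis null_setsD2)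
    have "emeasure lebesgue U = emeasure lebesgue (U - N)"
      using Nl U by (simp add: emeasure_Diff_null_set lborelD)
    then have Um: "U \<in> lmeasurable" and "measure lebesgue U < \<delta>"
      using U \<open>\<delta> > 0\<close> by (auto simp: fmeasurable_def measure_def enn2real_less_iff 
        intro: order.strict_trans lborelD)
    have "\<forall>x. \<exists>d>0. x \<in> {l..r} - N \<longrightarrow>
         (\<forall>y\<in>{l..r}. norm (y-x) < d \<longrightarrow> norm (f y - f x - (y-x) *\<^sub>R f' x) \<le> e/2 * norm (y-x))"
      using vd[unfolded has_vector_derivative_def has_derivative_within_alt] half_gt_zero[OF \<open>e > 0\<close>]
      by (metis zero_less_one)
    then obtain d where d: "\<And>x. 0 < d x"
                 "\<And>x y. \<lbrakk>x \<in> {l..r} - N; y \<in> {l..r}; norm (y-x) < d x\<rbrakk>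
                        \<Longrightarrow> norm (f y - f x - (y-x) *\<^sub>R f' x) \<le> e/2 * norm (y-x)"
      by metis
    define \<gamma> where "\<gamma> x = (if x \<in> N then U else ball x (d x))" for x
    have "gauge \<gamma>"
      using U d(1) by (auto simp: gauge_def \<gamma>_def)
    moreover have "norm ((\<Sum>(x, k)\<in>p. measure lborel k *\<^sub>R g x) - (f r - f l)) \<le> e * measure lborel {l..r}"
      if p: "p tagged_division_of {l..r}" "\<gamma> fine p" for p
    proof -
      have ba: "r - l = (\<Sum>(x,K)\<in>p. Sup K - Inf K)" "f r - f l = (\<Sum>(x,K)\<in>p. f (Sup K) - f (Inf K))"
        using additive_tagged_division_1[where f= "\<lambda>x. x"] additive_tagged_division_1[where f= f]
            \<open>l \<le> r\<close> p by auto
      have fin: "finite p" using p by blast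
      have K: "\<exists>u v. K = {u..v} \<and> u \<le> v \<and> l \<le> u \<and> v \<le> r \<and> x \<in> {u..v} \<and> {u..v} \<subseteq> \<gamma> x" if xK: "(x, K) \<in> p" for x K
      proof -
        obtain u v where uv: "K = cbox u v" "x \<in> K" "K \<subseteq> {l..r}"
          using tagged_division_ofD(2,3,4)[OF p(1) xK] by auto
        moreover have "K \<subseteq> \<gamma> x" using p(2) that by (auto simp: fine_def)
        ultimately show ?thesis by (intro exI[of _ u] exI[of _ v]) auto
      qed
      have "norm ((\<Sum>(x, k)\<in>p. measure lborel k *\<^sub>R g x) - (f r - f l))
          = norm (\<Sum>(x, K)\<in>p. measure lborel K *\<^sub>R g x - (f (Sup K) - f (Inf K)))"
        unfolding ba(2) by (simp add: sum_subtractf split_def)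
      also have "\<dots> \<le> (\<Sum>q\<in>p. e/2 * (case q of (x, K) \<Rightarrow> Sup K - Inf K) +
            (case q of (x, K) \<Rightarrow> if x \<in> N then dist (f (Inf K)) (f (Sup K)) else 0))"
      proof (rule sum_norm_le, safe)
        fix x K
        assume xK: "(x, K) \<in> p"
        from K[OF this] obtain u v where uv: "K = {u..v}" "u \<le> v" "l \<le> u" "v \<le> r" "x \<in> {u..v}" "{u..v} \<subseteq> \<gamma> x"
          by blast
        show "norm (measure lborel K *\<^sub>R g x - (f (Sup K) - f (Inf K))) \<le> e/2 * (Sup K - Inf K) +
            (if x \<in> N then dist (f (Inf K)) (f (Sup K)) else 0)"
        proof (cases "x \<in> N")
          case True
          then show ?thesis using uv \<open>e > 0\<close> by (simp add: g_def dist_norm norm_minus_commute)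
        next
          case False
          have xlr: "x \<in> {l..r} - N" using False uv by auto
          have "u \<in> ball x (d x)" "v \<in> ball x (d x)" using uv(2,6) False by (simp_all add: \<gamma>_def subset_iff)
          then have *: "norm (u - x) < d x" "norm (v - x) < d x" by (auto simp: dist_real_def)
          have "norm ((v - u) *\<^sub>R f' x - (f v - f u))
             = norm (f u - f x - (u - x) *\<^sub>R f' x - (f v - f x - (v - x) *\<^sub>R f' x))"
            by (auto simp: algebra_simps)
          also have "\<dots> \<le> norm (f u - f x - (u - x) *\<^sub>R f' x) + norm (f v - f x - (v - x) *\<^sub>R f' x)"
            by (rule norm_triangle_ineq4)
          also have "\<dots> \<le> e/2 * norm (u - x) + e/2 * norm (v - x)"
            using uv by (intro add_mono d(2)[OF xlr] *) auto
          \<comment> \<open>The tag lies between \<open>u\<close> and \<open>v\<close>, so its two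
            distances add up to the length.\<close>
          also have "\<dots> = e/2 * (v - u)" using uv(5) by (simp add: field_simps)
          finally show ?thesis using uv False by (simp add: g_def)
        qed
      qed
      also have "\<dots> = e/2 * (r - l) + (\<Sum>(x, K)\<in>p. if x \<in> N then dist (f (Inf K)) (f (Sup K)) else 0)"
        unfolding ba(1) by (simp add: sum.distrib sum_distrib_left split_def)
      also have "(\<Sum>(x, K)\<in>p. if x \<in> N then dist (f (Inf K)) (f (Sup K)) else 0) \<le> e * (r - l) / 2"
      proof -
        \<comment> \<open>Degenerate intervals contribute nothing and are dropped. An interval of
          positive length has nonempty interior, so disjoint interiors force distinct endpoint
          pairs, which makes \<open>h\<close> injective on \<open>q\<close>.\<close>
        define q where "q = {(x, K) \<in> p. x \<in> N \<and> Inf K < Sup K}"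
        define h where "h = (\<lambda>(x::real, K::real set). (Inf K, Sup K))"
        have Kb: "K = {Inf K..Sup K}" "Inf K \<le> Sup K" "l \<le> Inf K" "Sup K \<le> r" "{Inf K..Sup K} \<subseteq> \<gamma> x"
          if "(x, K) \<in> p" for x K
          using K[OF that] by auto
        have "(\<Sum>(x, K)\<in>p. if x \<in> N then dist (f (Inf K)) (f (Sup K)) else 0)
            = (\<Sum>(x, K)\<in>q. dist (f (Inf K)) (f (Sup K)))"
          
        proof (intro sum.mono_neutral_cong_right fin ballI)
          fix s assume s: "s \<in> p - q"
          obtain x K where "s = (x, K)" by fastforce
          then show "(case s of (x, K) \<Rightarrow> if x \<in> N then dist (f (Inf K)) (f (Sup K)) else 0) = 0"
            using s Kb(2)[of x K] by (auto simp: q_def)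
        qed (auto simp: q_def)
        also have disj: "{Inf K<..<Sup K} \<inter> {Inf L<..<Sup L} = {}"
          if "(x, K) \<in> p" "(y, L) \<in> p" "(x, K) \<noteq> (y, L)" for x y K L
        proof -
          have "interior K \<inter> interior L = {}"
            using tagged_division_ofD(5)[OF p(1) that] .
          then show ?thesis 
            using Kb(1)[OF that(1)] Kb(1)[OF that(2)] by (metis interior_atLeastAtMost_real)
        qed
        have inj: "inj_on h q"
        proof (rule inj_onI, clarify)
          fix x K y L
          assume q: "(x, K) \<in> q" "(y, L) \<in> q" and h: "h (x, K) = h (y, L)"
          show "x = y \<and> K = L"
          proof (rule ccontr)
            assume "\<not> (x = y \<and> K = L)"
            then have "{Inf K<..<Sup K} \<inter> {Inf L<..<Sup L} = {}"
              using q by (intro disj[of x K y L]) (auto simp: q_def)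
            then show False using h q by (auto simp: h_def q_def)
          qed
        qed
        have "(\<Sum>(x, K)\<in>q. dist (f (Inf K)) (f (Sup K))) = (\<Sum>(u, v)\<in>h ` q. dist (f u) (f v))"
          by (subst sum.reindex[OF inj]) (simp add: h_def split_def)
        also have "\<dots> < e * (r - l) / 2"
        proof (rule \<delta>)
          show fq: "finite (h ` q)" using fin by (auto simp: q_def intro: finite_subset)
          show hb: "\<forall>(u, v)\<in>h ` q. l \<le> u \<and> u \<le> v \<and> v \<le> r"
            using Kb(2,3,4) by (fastforce simp: q_def h_def)
          show hd: "disjoint_family_on (\<lambda>(u, v). {u<..<v}) (h ` q)"
            unfolding disjoint_family_on_def
          proof (intro ballI impI)
            fix s s'
            assume "s \<in> h ` q" "s' \<in> h ` q" "s \<noteq> s'"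
            then obtain x K y L where "(x, K) \<in> q" "(y, L) \<in> q" "s = h (x, K)" "s' = h (y, L)" "(x, K) \<noteq> (y, L)"
              by auto
            then show "(\<lambda>(u, v). {u<..<v}) s \<inter> (\<lambda>(u, v). {u<..<v}) s' = {}"
              using disj[of x K y L] by (auto simp: h_def q_def)
          qed
          have "(\<Sum>(u, v)\<in>h ` q. v - u) \<le> measure lebesgue U"
          proof (rule disjoint_intervals_length_le[OF fq _ hd Um])
            fix u v
            assume "(u, v) \<in> h ` q"
            then show "u \<le> v" using hb by auto
            show "{u<..<v} \<subseteq> U" using \<open>(u, v) \<in> h ` q\<close> Kb(5)
              by (fastforce simp: q_def h_def \<gamma>_def)
          qed
          also have "\<dots> < \<delta>" by fact
          finally show "(\<Sum>(u, v)\<in>h ` q. v - u) < \<delta>" .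
        qed
        finally show ?thesis by simp
      qed
      finally show ?thesis using \<open>l < r\<close> by (simp add: field_simps)
    qed
    ultimately show "\<exists>d. gauge d \<and> (\<forall>p. p tagged_division_of {l..r} \<and> d fine p \<longrightarrow>
      norm ((\<Sum>(x, k)\<in>p. measure lborel k *\<^sub>R g x) - (f r - f l)) \<le> e * measure lborel {l..r})"
      by (intro exI[of _ \<gamma>] conjI allI impI) auto
  qed
  then show ?thesis
    using has_integral_spike[OF N, of "{l..r}" f' g "f r - f l"] by (simp add: g_def)
qed

text \<open>Two distances occur because the controlling function may take its values in another
  space: this covers products with a smooth factor, through the Lipschitz term \<open>C\<close>, and
  coefficients of a function with values in \<open>L2\<close>, through the factor
  \<open>B\<close>.\<close>

lemma abs_cont_on_bound:
  assumes ac: "abs_cont_on d l r f" and "0 \<le> B" "0 \<le> C"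
    and le: "\<And>u v. l \<le> u \<Longrightarrow> u \<le> v \<Longrightarrow> v \<le> r \<Longrightarrow> d' (g u) (g v) \<le> B * d (f u) (f v) + C * (v - u)"
  shows "abs_cont_on d' l r g"
  unfolding abs_cont_on_def
proof (intro allI impI)
  fix \<epsilon> :: real
  assume "\<epsilon> > 0"
  then have "\<epsilon> / 2 / (B + 1) > 0" using \<open>0 \<le> B\<close> by simp
  then obtain \<delta> where "\<delta> > 0" and \<delta>: "\<And>P. finite P \<Longrightarrow>
        (\<forall>(u, v)\<in>P. l \<le> u \<and> u \<le> v \<and> v \<le> r) \<Longrightarrow>
        disjoint_family_on (\<lambda>(u, v). {u<..<v}) P \<Longrightarrow>
        (\<Sum>(u, v)\<in>P. v - u) < \<delta> \<Longrightarrow> (\<Sum>(u, v)\<in>P. d (f u) (f v)) < \<epsilon> / 2 / (B + 1)"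
    using ac unfolding abs_cont_on_def by meson
  show "\<exists>\<delta>>0. \<forall>P. finite P \<and>
        (\<forall>(u, v)\<in>P. l \<le> u \<and> u \<le> v \<and> v \<le> r) \<and>
        disjoint_family_on (\<lambda>(u, v). {u<..<v}) P \<and>
        (\<Sum>(u, v)\<in>P. v - u) < \<delta>
      \<longrightarrow> (\<Sum>(u, v)\<in>P. d' (g u) (g v)) < \<epsilon>"
  \<comment> \<open>The summand 1 in both denominators admits \<open>B = 0\<close> and
    \<open>C = 0\<close> and makes the final estimate strict.\<close>
  proof (intro exI[of _ "min \<delta> (\<epsilon> / 2 / (C + 1))"] conjI allI impI; (elim conjE)?)
    show "0 < min \<delta> (\<epsilon> / 2 / (C + 1))" using \<open>\<delta> > 0\<close> \<open>\<epsilon> > 0\<close> \<open>0 \<le> C\<close> by simp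
  next
    fix P
    assume P: "finite P" "\<forall>(u, v)\<in>P. l \<le> u \<and> u \<le> v \<and> v \<le> r"
        "disjoint_family_on (\<lambda>(u, v). {u<..<v}) P"
        "(\<Sum>(u, v)\<in>P. v - u) < min \<delta> (\<epsilon> / 2 / (C + 1))"
    have "(\<Sum>(u, v)\<in>P. d' (g u) (g v)) \<le> (\<Sum>(u, v)\<in>P. B * d (f u) (f v) + C * (v - u))"
      using P(2) le by (intro sum_mono) fastforce
    also have "\<dots> = B * (\<Sum>(u, v)\<in>P. d (f u) (f v)) + C * (\<Sum>(u, v)\<in>P. v - u)"
      by (simp add: sum.distrib sum_distrib_left split_def)
    also have "\<dots> \<le> B * (\<epsilon> / 2 / (B + 1)) + C * (\<epsilon> / 2 / (C + 1))"
      using \<delta>[OF P(1,2,3)] P(4) assms(2,3) by (intro add_mono mult_left_mono) auto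
    also have "\<dots> < \<epsilon> / 2 + \<epsilon> / 2"
      using \<open>\<epsilon> > 0\<close> assms(2,3) by (intro add_strict_mono) (auto simp: field_simps)
    finally show "(\<Sum>(u, v)\<in>P. d' (g u) (g v)) < \<epsilon>" by simp
  qed
qed

lemma abs_cont_on_subset:
  assumes "abs_cont_on d l r f" "l \<le> u" "v \<le> r"
  shows "abs_cont_on d u v f"
  unfolding abs_cont_on_def
proof (intro allI impI)
  fix \<epsilon> :: real
  assume "\<epsilon> > 0"
  then obtain \<delta> where "\<delta> > 0" and \<delta>: "\<And>P. finite P \<Longrightarrow>
        (\<forall>(u, v)\<in>P. l \<le> u \<and> u \<le> v \<and> v \<le> r) \<Longrightarrow>
        disjoint_family_on (\<lambda>(u, v). {u<..<v}) P \<Longrightarrow>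
        (\<Sum>(u, v)\<in>P. v - u) < \<delta> \<Longrightarrow> (\<Sum>(u, v)\<in>P. d (f u) (f v)) < \<epsilon>"
    using assms(1) unfolding abs_cont_on_def by meson
  show "\<exists>\<delta>>0. \<forall>P. finite P \<and> (\<forall>(x, y)\<in>P. u \<le> x \<and> x \<le> y \<and> y \<le> v) \<and>
        disjoint_family_on (\<lambda>(u, v). {u<..<v}) P \<and> (\<Sum>(u, v)\<in>P. v - u) < \<delta>
      \<longrightarrow> (\<Sum>(u, v)\<in>P. d (f u) (f v)) < \<epsilon>"
  proof (intro exI[of _ \<delta>] conjI allI impI \<open>\<delta> > 0\<close>; elim conjE)
    fix P
    assume P: "finite P" "\<forall>(x, y)\<in>P. u \<le> x \<and> x \<le> y \<and> y \<le> v"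
        "disjoint_family_on (\<lambda>(u, v). {u<..<v}) P" "(\<Sum>(u, v)\<in>P. v - u) < \<delta>"
    have "\<forall>(x, y)\<in>P. l \<le> x \<and> x \<le> y \<and> y \<le> r"
      using P(2) assms(2,3) by fastforce
    then show "(\<Sum>(u, v)\<in>P. d (f u) (f v)) < \<epsilon>"
      using P(1,3,4) by (intro \<delta>)
  qed
qed

lemma abs_cont_on_imp_continuous_on:
  fixes f :: "real \<Rightarrow> 'b::metric_space"
  assumes "abs_cont_on dist l r f"
  shows "continuous_on {l..r} f"
  unfolding continuous_on_iff
proof (intro ballI allI impI)
  fix x \<epsilon> :: real
  assume x: "x \<in> {l..r}" and "\<epsilon> > 0"
  then obtain \<delta> where "\<delta> > 0" and \<delta>: "\<And>P. finite P \<Longrightarrow>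
        (\<forall>(u, v)\<in>P. l \<le> u \<and> u \<le> v \<and> v \<le> r) \<Longrightarrow>
        disjoint_family_on (\<lambda>(u, v). {u<..<v}) P \<Longrightarrow>
        (\<Sum>(u, v)\<in>P. v - u) < \<delta> \<Longrightarrow> (\<Sum>(u, v)\<in>P. dist (f u) (f v)) < \<epsilon>"
    using assms unfolding abs_cont_on_def by meson
  have "dist (f y) (f x) < \<epsilon>" if "y \<in> {l..r}" "dist y x < \<delta>" for y
    using \<delta>[of "{(min x y, max x y)}"] x that
    by (auto simp: disjoint_family_on_def dist_real_def min_def max_def dist_commute abs_if split: if_splits)
  then show "\<exists>d>0. \<forall>x'\<in>{l..r}. dist x' x < d \<longrightarrow> dist (f x') (f x) < \<epsilon>"
    using \<open>\<delta> > 0\<close> by blast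
qed

text \<open>On a compact interval a C1 factor is bounded and Lipschitz, and \<open>f\<close> is
  bounded because it is continuous; splitting the increment of the product as in the product rule
  then fits \<open>abs_cont_on_bound\<close>.\<close>

lemma abs_cont_on_scaleR:
  fixes f :: "real \<Rightarrow> 'b::real_normed_vector" and \<phi> :: "real \<Rightarrow> real"
  assumes ac: "abs_cont_on dist l r f"
    and \<phi>: "\<And>x. x \<in> {l..r} \<Longrightarrow> (\<phi> has_real_derivative \<phi>' x) (at x within {l..r})"
    and \<phi>': "continuous_on {l..r} \<phi>'"
  shows "abs_cont_on dist l r (\<lambda>x. \<phi> x *\<^sub>R f x)"
proof -
  have bdd: "\<exists>B\<ge>0. \<forall>x\<in>{l..r}. norm (h x) \<le> B" if "continuous_on {l..r} h"
    for h :: "real \<Rightarrow> 'c::real_normed_vector"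
  proof -
    have "bounded (h ` {l..r})"
      by (intro compact_imp_bounded compact_continuous_image that) simp
    then show ?thesis by (auto simp: bounded_pos intro: less_imp_le)
  qed
  have "continuous_on {l..r} \<phi>"
    using \<phi> by (meson DERIV_continuous continuous_on_eq_continuous_within)
  then obtain B where B: "B \<ge> 0" "\<And>x. x \<in> {l..r} \<Longrightarrow> norm (\<phi> x) \<le> B" using bdd by blast
  obtain L where L: "L \<ge> 0" "\<And>x. x \<in> {l..r} \<Longrightarrow> norm (\<phi>' x) \<le> L" using bdd[OF \<phi>'] by blast
  obtain M where M: "M \<ge> 0" "\<And>x. x \<in> {l..r} \<Longrightarrow> norm (f x) \<le> M"
    using bdd[OF abs_cont_on_imp_continuous_on[OF ac]] by blast
  show ?thesis
  proof (rule abs_cont_on_bound[OF ac B(1)])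
    show "0 \<le> M * L" using L M by simp
    fix u v
    assume uv: "l \<le> u" "u \<le> v" "v \<le> r"
    have "norm (\<phi> v - \<phi> u) \<le> L * norm (v - u)"
      using uv by (intro field_differentiable_bound[of "{l..r}" \<phi> \<phi>'] \<phi> L) auto
    then have *: "norm (\<phi> u - \<phi> v) \<le> L * (v - u)" using uv by simp
    have "\<phi> u *\<^sub>R f u - \<phi> v *\<^sub>R f v = \<phi> u *\<^sub>R (f u - f v) + (\<phi> u - \<phi> v) *\<^sub>R f v"
      by (simp add: algebra_simps)
    then have "dist (\<phi> u *\<^sub>R f u) (\<phi> v *\<^sub>R f v) \<le> norm (\<phi> u *\<^sub>R (f u - f v)) + norm ((\<phi> u - \<phi> v) *\<^sub>R f v)"
      unfolding dist_norm by (metis norm_triangle_ineq)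
    also have "\<dots> = norm (\<phi> u) * dist (f u) (f v) + norm (\<phi> u - \<phi> v) * norm (f v)"
      by (simp add: dist_norm)
    also have "\<dots> \<le> B * dist (f u) (f v) + (L * (v - u)) * M"
      using uv L M B * by (intro add_mono mult_mono mult_right_mono) auto
    finally show "dist (\<phi> u *\<^sub>R f u) (\<phi> v *\<^sub>R f v) \<le> B * dist (f u) (f v) + M * L * (v - u)"
      by (simp add: algebra_simps)
  qed
qed

lemma AE_lebesgue_on_negligibleE:
  assumes "AE x in lebesgue_on S. P x" and "S \<in> sets lebesgue"
  obtains N where "negligible N" "\<And>x. x \<in> S - N \<Longrightarrow> P x"
proof -
  have "AE x in lebesgue. x \<in> S \<longrightarrow> P x"
    using assms by (subst (asm) AE_restrict_space_iff) auto
  then obtain N where "N \<in> null_sets lebesgue" "{x \<in> space lebesgue. \<not> (x \<in> S \<longrightarrow> P x)} \<subseteq> N"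
    by (rule AE_E3) blast
  then show ?thesis by (intro that[of N]) (auto simp: negligible_iff_null_sets)
qed

lemma AE_lebesgue_on_subset:
  assumes "AE x in lebesgue_on S. P x" "T \<subseteq> S" "S \<in> sets lebesgue" "T \<in> sets lebesgue"
  shows "AE x in lebesgue_on T. P x"
proof -
  have "AE x in lebesgue. x \<in> S \<longrightarrow> P x"
    using assms by (subst (asm) AE_restrict_space_iff) auto
  then have "AE x in lebesgue. x \<in> T \<longrightarrow> P x"
    by eventually_elim (use assms(2) in auto)
  then show ?thesis using assms(4) by (subst AE_restrict_space_iff) auto
qed

text \<open>It serves in space with a trigonometric factor and in time with an exponential
  integrating factor. The product stays absolutely continuous, so the fundamental theorem applies to
  it directly.\<close>

lemma abs_cont_integration_by_parts:
  fixes f :: "real \<Rightarrow> 'b::banach" and \<phi> :: "real \<Rightarrow> real"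
  assumes ac: "abs_cont_on dist l r f" and "l \<le> r"
    and f: "AE x in lebesgue_on {l..r}. (f has_vector_derivative f' x) (at x within {l..r})"
    and \<phi>: "\<And>x. x \<in> {l..r} \<Longrightarrow> (\<phi> has_real_derivative \<phi>' x) (at x within {l..r})"
    and \<phi>': "continuous_on {l..r} \<phi>'"
  shows "((\<lambda>x. \<phi> x *\<^sub>R f' x + \<phi>' x *\<^sub>R f x) has_integral (\<phi> r *\<^sub>R f r - \<phi> l *\<^sub>R f l)) {l..r}"
proof -
  obtain N where "negligible N" "\<And>x. x \<in> {l..r} - N \<Longrightarrow> (f has_vector_derivative f' x) (at x within {l..r})"
    using AE_lebesgue_on_negligibleE[OF f] by auto
  then show ?thesis
    using \<open>l \<le> r\<close> \<phi> by (intro abs_cont_fundamental_theorem[of _ _ "\<lambda>x. \<phi> x *\<^sub>R f x" N] abs_cont_on_scaleR[OF ac \<phi> \<phi>'])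
      (auto intro!: derivative_eq_intros)
qed

section \<open>Square integrable functions\<close>

text \<open>Completeness of Lebesgue measure is the reason; extension by zero outside
  \<open>S\<close> reduces the claim to the whole space.\<close>

lemma borel_measurable_lebesgue_on_AE:
  fixes f g :: "'a::euclidean_space \<Rightarrow> 'b::euclidean_space"
  assumes "f \<in> borel_measurable (lebesgue_on S)" "S \<in> sets lebesgue"
    and "AE x in lebesgue_on S. f x = g x"
  shows "g \<in> borel_measurable (lebesgue_on S)"
proof -
  have "AE x in lebesgue. x \<in> S \<longrightarrow> f x = g x"
    using assms by (subst (asm) AE_restrict_space_iff) auto
  then have "AE x in lebesgue. (if x \<in> S then f x else 0) = (if x \<in> S then g x else 0)"
    by eventually_elim auto
  moreover have "(\<lambda>x. if x \<in> S then f x else 0) \<in> borel_measurable lebesgue"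
    using assms by (subst borel_measurable_if) auto
  ultimately have "(\<lambda>x. if x \<in> S then g x else 0) \<in> borel_measurable lebesgue"
    by (rule borel_measurable_AE[rotated])
  then show ?thesis using assms by (subst (asm) borel_measurable_if) auto
qed

lemma L2_continuous:
  fixes f :: "real \<Rightarrow> 'v::euclidean_space"
  assumes "continuous_on {0..2*pi} f"
  shows "f \<in> L2"
proof -
  have "continuous_on {0..2*pi} (\<lambda>x. (norm (f x))\<^sup>2)"
    by (intro continuous_intros assms)
  then have "integrable Omega (\<lambda>x. (norm (f x))\<^sup>2)"
    by (rule continuous_imp_integrable_real)
  moreover have "{0..2*pi} \<in> sets lebesgue" by simp
  then have "f \<in> borel_measurable Omega"
    by (rule continuous_imp_measurable_on_sets_lebesgue[OF assms])
  ultimately show ?thesis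
    unfolding L2_def by (intro CollectI conjI)
qed

lemma L2_AE_cong:
  assumes "f \<in> L2" "AE x in Omega. f x = g x"
  shows "g \<in> L2" "L2_norm g = L2_norm f"
proof -
  have f: "f \<in> borel_measurable Omega" using assms by (simp add: L2_def)
  have g: "g \<in> borel_measurable Omega"
    by (rule borel_measurable_lebesgue_on_AE[OF f _ assms(2)]) simp
  have *: "AE x in Omega. (norm (f x))\<^sup>2 = (norm (g x))\<^sup>2" using assms(2) by eventually_elim simp
  show "g \<in> L2"
    using assms(1) g integrable_cong_AE_imp[OF _ _ *] by (simp add: L2_def)
  show "L2_norm g = L2_norm f"
    unfolding L2_norm_def using integral_cong_AE[OF _ _ *] f g by simp
qed

lemma L2_norm_nonneg: "0 \<le> L2_norm f"
  by (simp add: L2_norm_def)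

lemma L2_norm_square: "(L2_norm f)\<^sup>2 = (LINT x|Omega. (norm (f x))\<^sup>2)"
  by (simp add: L2_norm_def)

lemma L2_norm_norm: "L2_norm (\<lambda>x. norm (f x)) = L2_norm f"
  by (simp add: L2_norm_def)

lemma L2_norm_minus_commute: "L2_norm (\<lambda>x. f x - g x) = L2_norm (\<lambda>x. g x - f x)"
  by (simp add: L2_norm_def norm_minus_commute)

lemma L2_scaleR: "f \<in> L2 \<Longrightarrow> (\<lambda>x. c *\<^sub>R f x) \<in> L2"
  by (auto simp: L2_def power_mult_distrib)

lemma L2_norm_scaleR: "L2_norm (\<lambda>x. c *\<^sub>R f x) = \<bar>c\<bar> * L2_norm f"
  by (simp add: L2_norm_def power_mult_distrib real_sqrt_mult)

lemma L2_norm_mem: "f \<in> L2 \<Longrightarrow> (\<lambda>x. norm (f x)) \<in> L2"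
  by (auto simp: L2_def)

lemma L2_add:
  assumes "f \<in> L2" "g \<in> L2"
  shows "(\<lambda>x. f x + g x) \<in> L2"
proof -
  have "integrable Omega (\<lambda>x. (norm (f x + g x))\<^sup>2)"
  proof (rule Bochner_Integration.integrable_bound)
    show "integrable Omega (\<lambda>x. 2 * ((norm (f x))\<^sup>2 + (norm (g x))\<^sup>2))"
      using assms by (auto simp: L2_def)
    show "(\<lambda>x. (norm (f x + g x))\<^sup>2) \<in> borel_measurable Omega"
      using assms by (auto simp: L2_def)
    show "AE x in Omega. norm ((norm (f x + g x))\<^sup>2) \<le> norm (2 * ((norm (f x))\<^sup>2 + (norm (g x))\<^sup>2))"
    proof (intro AE_I2)
      fix x
      have "(norm (f x + g x))\<^sup>2 \<le> (norm (f x) + norm (g x))\<^sup>2"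
        by (intro power_mono norm_triangle_ineq norm_ge_zero)
      also have "\<dots> \<le> 2 * ((norm (f x))\<^sup>2 + (norm (g x))\<^sup>2)"
        using zero_le_power2[of "norm (f x) - norm (g x)"] by (simp add: power2_eq_square algebra_simps)
      finally show "norm ((norm (f x + g x))\<^sup>2) \<le> norm (2 * ((norm (f x))\<^sup>2 + (norm (g x))\<^sup>2))" by simp
    qed
  qed
  then show ?thesis using assms by (auto simp: L2_def)
qed

lemma L2_diff:
  assumes "f \<in> L2" "g \<in> L2"
  shows "(\<lambda>x. f x - g x) \<in> L2"
  using L2_add[OF assms(1) L2_scaleR[OF assms(2), of "-1"]] by simp

lemma L2_integrable_scaleR:
  fixes f :: "real \<Rightarrow> real"
  assumes "f \<in> L2" "g \<in> L2"
  shows "integrable Omega (\<lambda>x. f x *\<^sub>R g x)"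
proof (rule Bochner_Integration.integrable_bound)
  show "integrable Omega (\<lambda>x. (norm (f x))\<^sup>2 + (norm (g x))\<^sup>2)"
    using assms by (auto simp: L2_def)
  show "(\<lambda>x. f x *\<^sub>R g x) \<in> borel_measurable Omega"
    using assms by (auto simp: L2_def)
  show "AE x in Omega. norm (f x *\<^sub>R g x) \<le> norm ((norm (f x))\<^sup>2 + (norm (g x))\<^sup>2)"
  proof (intro AE_I2)
    fix x
    show "norm (f x *\<^sub>R g x) \<le> norm ((norm (f x))\<^sup>2 + (norm (g x))\<^sup>2)"
      using sum_squares_bound[of "norm (f x)" "norm (g x)"] zero_le_power2[of "norm (f x)"]
        zero_le_power2[of "norm (g x)"]
      unfolding norm_scaleR real_norm_def abs_of_nonneg[OF add_nonneg_nonneg[OF zero_le_power2 zero_le_power2]]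
      by linarith
  qed
qed

section \<open>The Cauchy-Schwarz and triangle inequalities in \<open>L2\<close>\<close>

lemma quadratic_nonneg_imp_discriminant:
  fixes a b c :: real
  assumes "\<And>s. 0 \<le> a - 2 * s * b + s\<^sup>2 * c" "0 \<le> a" "0 \<le> c"
  shows "b \<le> sqrt a * sqrt c"
proof (cases "c = 0")
  case True
  show ?thesis
  proof (rule ccontr)
    assume "\<not> ?thesis"
    then have "b > 0" using True by simp
    \<comment> \<open>With \<open>c = 0\<close> the expression is affine in \<open>s\<close> with
      negative slope, and this \<open>s\<close> gives it the value \<open>- a - 2\<close>.\<close>
    then show False using assms(1)[of "(a + 1) / b"] True assms(2) by simp
  qed
next
  case False
  then have "c > 0" using assms by simp
  \<comment> \<open>\<open>b / c\<close> minimises the quadratic in \<open>s\<close>.\<close>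
  then have "b\<^sup>2 \<le> a * c" using assms(1)[of "b / c"] by (simp add: power2_eq_square field_simps)
  then show ?thesis by (metis real_le_rsqrt real_sqrt_mult)
qed

lemma L2_Cauchy_Schwarz_real:
  fixes f g :: "real \<Rightarrow> real"
  assumes "f \<in> L2" "g \<in> L2"
  shows "(LINT x|Omega. f x * g x) \<le> L2_norm f * L2_norm g"
  unfolding L2_norm_def
proof (rule quadratic_nonneg_imp_discriminant)
  fix s :: real
  have i: "integrable Omega (\<lambda>x. (f x)\<^sup>2)" "integrable Omega (\<lambda>x. (g x)\<^sup>2)" "integrable Omega (\<lambda>x. f x * g x)"
    using assms L2_integrable_scaleR[OF assms] by (auto simp: L2_def)
  have "0 \<le> (LINT x|Omega. (f x - s * g x)\<^sup>2)" by simp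
  also have "\<dots> = (LINT x|Omega. (f x)\<^sup>2 - 2 * s * (f x * g x) + s\<^sup>2 * (g x)\<^sup>2)"
    by (intro Bochner_Integration.integral_cong refl) (simp add: power2_eq_square algebra_simps)
  also have "\<dots> = (LINT x|Omega. (f x)\<^sup>2) - 2 * s * (LINT x|Omega. f x * g x) + s\<^sup>2 * (LINT x|Omega. (g x)\<^sup>2)"
    using i by simp
  finally show "0 \<le> (LINT x|Omega. (norm (f x))\<^sup>2) - 2 * s * (LINT x|Omega. f x * g x)
      + s\<^sup>2 * (LINT x|Omega. (norm (g x))\<^sup>2)" by simp
qed auto

lemma L2_Cauchy_Schwarz:
  fixes f :: "real \<Rightarrow> real"
  assumes "f \<in> L2" "g \<in> L2"
  shows "norm (LINT x|Omega. f x *\<^sub>R g x) \<le> L2_norm f * L2_norm g"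
proof -
  have "norm (LINT x|Omega. f x *\<^sub>R g x) \<le> (LINT x|Omega. norm (f x *\<^sub>R g x))"
    by (rule integral_norm_bound)
  also have "\<dots> = (LINT x|Omega. norm (f x) * norm (g x))" by simp
  also have "\<dots> \<le> L2_norm f * L2_norm g"
    using L2_Cauchy_Schwarz_real[OF L2_norm_mem[OF assms(1)] L2_norm_mem[OF assms(2)]]
    by (simp only: L2_norm_norm)
  finally show ?thesis .
qed

lemma L2_norm_triangle:
  assumes "f \<in> L2" "g \<in> L2"
  shows "L2_norm (\<lambda>x. f x + g x) \<le> L2_norm f + L2_norm g"
proof (rule power2_le_imp_le)
  note fg = L2_norm_mem[OF assms(1)] L2_norm_mem[OF assms(2)]
  have i: "integrable Omega (\<lambda>x. (norm (f x))\<^sup>2)" "integrable Omega (\<lambda>x. (norm (g x))\<^sup>2)"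
      "integrable Omega (\<lambda>x. norm (f x) * norm (g x))" "integrable Omega (\<lambda>x. (norm (f x + g x))\<^sup>2)"
    using assms L2_integrable_scaleR[OF fg] L2_add[OF assms] by (auto simp: L2_def)
  have "(L2_norm (\<lambda>x. f x + g x))\<^sup>2 = (LINT x|Omega. (norm (f x + g x))\<^sup>2)"
    by (rule L2_norm_square)
  also have "\<dots> \<le> (LINT x|Omega. (norm (f x))\<^sup>2 + 2 * (norm (f x) * norm (g x)) + (norm (g x))\<^sup>2)"
  proof (intro integral_mono)
    fix x
    have "(norm (f x + g x))\<^sup>2 \<le> (norm (f x) + norm (g x))\<^sup>2"
      by (intro power_mono norm_triangle_ineq norm_ge_zero)
    then show "(norm (f x + g x))\<^sup>2 \<le> (norm (f x))\<^sup>2 + 2 * (norm (f x) * norm (g x)) + (norm (g x))\<^sup>2"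
      by (simp add: power2_eq_square algebra_simps)
  qed (use i in auto)
  also have "\<dots> = (L2_norm f)\<^sup>2 + 2 * (LINT x|Omega. norm (f x) * norm (g x)) + (L2_norm g)\<^sup>2"
    using i by (simp add: L2_norm_square)
  also have "\<dots> \<le> (L2_norm f)\<^sup>2 + 2 * (L2_norm f * L2_norm g) + (L2_norm g)\<^sup>2"
    using L2_Cauchy_Schwarz_real[OF fg] by (simp add: L2_norm_norm)
  finally show "(L2_norm (\<lambda>x. f x + g x))\<^sup>2 \<le> (L2_norm f + L2_norm g)\<^sup>2"
    by (simp add: power2_eq_square algebra_simps)
qed (simp add: L2_norm_nonneg)
lemma L2_norm_bound:
  assumes "f \<in> borel_measurable Omega" "\<And>x. x \<in> {0..2*pi} \<Longrightarrow> norm (f x) \<le> B" "0 \<le> B"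
  shows "L2_norm f \<le> sqrt (2 * pi) * B"
proof -
  have "(LINT x|Omega. (norm (f x))\<^sup>2) \<le> (LINT x|Omega. B\<^sup>2)"
  proof (rule integral_mono')
    show "integrable Omega (\<lambda>x. B\<^sup>2)" by (intro continuous_imp_integrable_real continuous_intros)
    show "(norm (f x))\<^sup>2 \<le> B\<^sup>2" if "x \<in> space Omega" for x
      using assms(2)[of x] that by (intro power_mono) auto
  qed simp
  also have "\<dots> = 2 * pi * B\<^sup>2" by (simp add: measure_restrict_space)
  finally have "L2_norm f \<le> sqrt (2 * pi * B\<^sup>2)"
    unfolding L2_norm_def by (rule real_sqrt_le_mono)
  then show ?thesis using assms(3) by (simp add: real_sqrt_mult)
qed

section \<open>Trigonometric polynomials\<close>

text \<open>Links the two integrals in use: antiderivatives and integration by parts yield gauge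
  integrals, while norms and coefficients are Lebesgue integrals.\<close>

lemma LINT_eq_has_integral:
  fixes f :: "real \<Rightarrow> 'v::euclidean_space"
  assumes "integrable Omega f" "(f has_integral I) {0..2*pi}"
  shows "(LINT x|Omega. f x) = I"
  by (rule has_integral_unique[OF has_integral_integral_lebesgue_on[OF assms(1)] assms(2)]) simp

text \<open>
  The trigonometric system indexed by the integers, cosines at \<open>k \<ge> 0\<close> and sines at \<open>k < 0\<close>,
  which makes differentiation read \<open>trig k' = k * trig (- k)\<close>.
\<close>

definition trig :: "int \<Rightarrow> real \<Rightarrow> real" where
  "trig k x = (if k \<ge> 0 then cos (of_int k * x) else sin (of_int k * x))"

lemma trig_0 [simp]: "trig 0 x = 1"
  by (simp add: trig_def)

lemma trig_periodic: "trig k (2 * pi) = trig k 0"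
  using sin_int_2pin[of k] cos_int_2pin[of k] by (simp add: trig_def mult.commute)

text \<open>The minus sign in the derivative of the cosine is absorbed by the negative frequency
  inside the sine, so one formula serves both halves of the system.\<close>

lemma has_derivative_trig:
  "(trig k has_real_derivative of_int k * trig (- k) x) (at x within S)"
proof (cases "k \<ge> 0")
  case True
  have "((\<lambda>x. cos (of_int k * x)) has_real_derivative of_int k * trig (- k) x) (at x within S)"
    by (rule derivative_eq_intros refl | use True in \<open>simp add: trig_def\<close>)+
  then show ?thesis using True by (simp add: trig_def[abs_def])
next
  case False
  have "((\<lambda>x. sin (of_int k * x)) has_real_derivative of_int k * trig (- k) x) (at x within S)"
    by (rule derivative_eq_intros refl | use False in \<open>simp add: trig_def\<close>)+
  then show ?thesis using False by (simp add: trig_def[abs_def])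
qed

lemma continuous_on_trig [continuous_intros]: "continuous_on S (trig k)"
  by (meson has_derivative_trig DERIV_continuous continuous_on_eq_continuous_within)

lemma trig_L2: "trig k \<in> L2"
  by (intro L2_continuous continuous_on_trig)

lemma integral_cos_int:
  assumes "m \<noteq> (0::int)"
  shows "(LINT x|Omega. cos (of_int m * x)) = 0"
proof (rule LINT_eq_has_integral)
  show "integrable Omega (\<lambda>x. cos (of_int m * x))"
    by (intro continuous_imp_integrable_real continuous_intros)
  have "((\<lambda>x. cos (of_int m * x)) has_integral
     sin (of_int m * (2 * pi)) / of_int m - sin (of_int m * 0) / of_int m) {0..2*pi}"
    by (rule fundamental_theorem_of_calculus)
      (use assms in \<open>auto simp flip: has_real_derivative_iff_has_vector_derivative intro!: derivative_eq_intros\<close>)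
  moreover have "sin (of_int m * (2 * pi)) = 0"
    using sin_int_2pin[of m] by (simp add: mult.commute)
  ultimately show "((\<lambda>x. cos (of_int m * x)) has_integral 0) {0..2*pi}" by simp
qed

lemma integral_sin_int: "(LINT x|Omega. sin (of_int m * x)) = 0"
proof (cases "m = 0")
  case False
  show ?thesis
  proof (rule LINT_eq_has_integral)
    show "integrable Omega (\<lambda>x. sin (of_int m * x))"
      by (intro continuous_imp_integrable_real continuous_intros)
    have "((\<lambda>x. sin (of_int m * x)) has_integral
       - cos (of_int m * (2 * pi)) / of_int m - - cos (of_int m * 0) / of_int m) {0..2*pi}"
      by (rule fundamental_theorem_of_calculus)
        (use False in \<open>auto simp flip: has_real_derivative_iff_has_vector_derivative intro!: derivative_eq_intros\<close>)
    moreover have "cos (of_int m * (2 * pi)) = 1"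
      using cos_int_2pin[of m] by (simp add: mult.commute)
    ultimately show "((\<lambda>x. sin (of_int m * x)) has_integral 0) {0..2*pi}" by simp
  qed
qed simp

lemma trig_mult:
  "trig j x * trig k x =
    (if j \<ge> 0 \<and> k \<ge> 0 then (cos (of_int (j - k) * x) + cos (of_int (j + k) * x)) / 2
     else if j < 0 \<and> k < 0 then (cos (of_int (j - k) * x) - cos (of_int (j + k) * x)) / 2
     else if j < 0 then (sin (of_int (j + k) * x) + sin (of_int (j - k) * x)) / 2
     else (sin (of_int (j + k) * x) - sin (of_int (j - k) * x)) / 2)"
  by (simp add: trig_def cos_times_cos sin_times_sin sin_times_cos cos_times_sin
      left_diff_distrib distrib_right)

lemma trig_orthogonal:
  assumes "j \<noteq> k"
  shows "(LINT x|Omega. trig j x * trig k x) = 0"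
proof -
  have i: "integrable Omega (\<lambda>x. cos (of_int m * x))" "integrable Omega (\<lambda>x. sin (of_int m * x))" for m :: int
    by (intro continuous_imp_integrable_real continuous_intros)+
  \<comment> \<open>Two cosines or two sines produce only cosines, whose frequencies
    \<open>j - k\<close> and \<open>j + k\<close> must both be nonzero; a mixed product produces
    only sines, which integrate to zero at every frequency.\<close>
  have "j + k \<noteq> 0" if "j \<ge> 0 \<longleftrightarrow> k \<ge> 0" using that assms by linarith
  then show ?thesis
    unfolding trig_mult using assms i
    by (cases "j \<ge> 0"; cases "k \<ge> 0")
      (simp_all add: integral_cos_int integral_sin_int del: of_int_add of_int_diff)
qed

text \<open>Pythagoras for an orthogonal system. The norms of the \<open>trig k\<close> stay
  unevaluated, since two such sums will be compared coefficient by coefficient.\<close>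

lemma L2_norm_trig_sum:
  assumes "finite A"
  shows "(L2_norm (\<lambda>x. \<Sum>k\<in>A. \<alpha> k * trig k x))\<^sup>2 = (\<Sum>k\<in>A. (\<alpha> k)\<^sup>2 * (L2_norm (trig k))\<^sup>2)"
proof -
  have i: "integrable Omega (\<lambda>x. trig j x * trig k x)" for j k
    by (intro continuous_imp_integrable_real continuous_intros)
  have "(L2_norm (\<lambda>x. \<Sum>k\<in>A. \<alpha> k * trig k x))\<^sup>2
      = (LINT x|Omega. (\<Sum>j\<in>A. \<Sum>k\<in>A. (\<alpha> j * \<alpha> k) * (trig j x * trig k x)))"
    unfolding L2_norm_square by (simp add: power2_eq_square sum_product mult_ac)
  also have "\<dots> = (\<Sum>j\<in>A. \<Sum>k\<in>A. (\<alpha> j * \<alpha> k) * (LINT x|Omega. trig j x * trig k x))"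
    using i by simp
  also have "\<dots> = (\<Sum>j\<in>A. \<Sum>k\<in>A. if k = j then (\<alpha> j)\<^sup>2 * (L2_norm (trig j))\<^sup>2 else 0)"
    using trig_orthogonal
    by (intro sum.cong refl) (auto simp: L2_norm_square simp flip: power2_eq_square)
  also have "\<dots> = (\<Sum>k\<in>A. (\<alpha> k)\<^sup>2 * (L2_norm (trig k))\<^sup>2)"
    using assms by simp
  finally show ?thesis .
qed

section \<open>Uniform approximation by trigonometric polynomials\<close>

definition trig_poly :: "(real \<Rightarrow> real) \<Rightarrow> bool" where
  "trig_poly p \<longleftrightarrow> (\<exists>A \<alpha>. finite A \<and> p = (\<lambda>x. \<Sum>k\<in>A. \<alpha> k * trig k x))"

lemma trig_poly_scale_trig: "trig_poly (\<lambda>x. c * trig k x)"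
  unfolding trig_poly_def by (intro exI[of _ "{k}"] exI[of _ "\<lambda>_. c"]) simp

lemma trig_poly_add:
  assumes "trig_poly p" "trig_poly q"
  shows "trig_poly (\<lambda>x. p x + q x)"
proof -
  obtain A \<alpha> B \<beta> where *: "finite A" "p = (\<lambda>x. \<Sum>k\<in>A. \<alpha> k * trig k x)"
      "finite B" "q = (\<lambda>x. \<Sum>k\<in>B. \<beta> k * trig k x)"
    using assms unfolding trig_poly_def by blast
  have "p x + q x = (\<Sum>k\<in>A \<union> B. ((if k \<in> A then \<alpha> k else 0) + (if k \<in> B then \<beta> k else 0)) * trig k x)" for x
  proof -
    have "p x = (\<Sum>k\<in>A \<union> B. (if k \<in> A then \<alpha> k else 0) * trig k x)"
      unfolding * using *(1,3) by (intro sum.mono_neutral_cong_left) auto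
    moreover have "q x = (\<Sum>k\<in>A \<union> B. (if k \<in> B then \<beta> k else 0) * trig k x)"
      unfolding * using *(1,3) by (intro sum.mono_neutral_cong_left) auto
    ultimately show ?thesis by (simp add: distrib_right sum.distrib)
  qed
  then show ?thesis
    unfolding trig_poly_def using *(1,3) by (intro exI[of _ "A \<union> B"] exI conjI ext) auto
qed

lemma trig_poly_scale:
  assumes "trig_poly p"
  shows "trig_poly (\<lambda>x. c * p x)"
proof -
  obtain A \<alpha> where "finite A" "p = (\<lambda>x. \<Sum>k\<in>A. \<alpha> k * trig k x)"
    using assms unfolding trig_poly_def by blast
  then show ?thesis
    unfolding trig_poly_def
    by (intro exI[of _ A] exI[of _ "\<lambda>k. c * \<alpha> k"]) (simp add: sum_distrib_left mult.assoc)
qed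

lemma trig_poly_const: "trig_poly (\<lambda>x. c)"
  using trig_poly_scale_trig[of c 0] by simp

lemma trig_poly_sum:
  assumes "\<And>i. i \<in> I \<Longrightarrow> trig_poly (f i)"
  shows "trig_poly (\<lambda>x. \<Sum>i\<in>I. f i x)"
  using assms by (induction I rule: infinite_finite_induct) (auto intro: trig_poly_add trig_poly_const)

lemma trig_poly_cos_int: "trig_poly (\<lambda>x. cos (of_int m * x))"
proof -
  have "cos (of_int m * x) = 1 * trig \<bar>m\<bar> x" for x
    by (cases "m \<ge> 0") (auto simp: trig_def)
  then show ?thesis by (simp only: trig_poly_scale_trig)
qed

lemma trig_poly_sin_int: "trig_poly (\<lambda>x. sin (of_int m * x))"
proof -
  have "sin (of_int m * x) = (- sgn (of_int m)) * trig (- \<bar>m\<bar>) x" for x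
    by (cases "m > 0"; cases "m = 0") (auto simp: trig_def)
  then show ?thesis by (simp only: trig_poly_scale_trig)
qed

lemma trig_poly_trig_mult: "trig_poly (\<lambda>x. trig j x * trig k x)"
proof -
  have s: "trig_poly (\<lambda>x. p x - q x)" if "trig_poly p" "trig_poly q" for p q
    using trig_poly_add[OF that(1) trig_poly_scale[OF that(2), of "-1"]] by simp
  have d: "trig_poly (\<lambda>x. p x / 2)" if "trig_poly p" for p
    using trig_poly_scale[OF that, of "1/2"] by simp
  show ?thesis
    unfolding trig_mult
    by (cases "j \<ge> 0"; cases "k \<ge> 0")
      (simp_all add: d s trig_poly_add trig_poly_cos_int trig_poly_sin_int del: of_int_add of_int_diff)
qed

lemma trig_poly_mult:
  assumes "trig_poly p" "trig_poly q"
  shows "trig_poly (\<lambda>x. p x * q x)"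
proof -
  obtain A \<alpha> B \<beta> where *: "p = (\<lambda>x. \<Sum>k\<in>A. \<alpha> k * trig k x)" "q = (\<lambda>x. \<Sum>k\<in>B. \<beta> k * trig k x)"
    using assms unfolding trig_poly_def by blast
  have "p x * q x = (\<Sum>j\<in>A. \<Sum>k\<in>B. (\<alpha> j * \<beta> k) * (trig j x * trig k x))" for x
    unfolding * by (simp add: sum_product mult_ac)
  then show ?thesis
    by (simp only: trig_poly_sum trig_poly_scale trig_poly_trig_mult)
qed

text \<open>A linear functional of \<open>cis x\<close> is a combination of \<open>cos x\<close> and
  \<open>sin x\<close>, and trigonometric polynomials form an algebra; induction over the polynomial
  does the rest.\<close>

lemma trig_poly_real_polynomial_cis:
  assumes "real_polynomial_function g"
  shows "trig_poly (\<lambda>x. g (cis x))"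
  using assms
proof (induction g rule: real_polynomial_function.induct)
  case (linear f)
  then interpret bounded_linear f .
  have "f (cis x) = cos (of_int 1 * x) * f 1 + sin (of_int 1 * x) * f \<i>" for x
  proof -
    have "cis x = cos x *\<^sub>R 1 + sin x *\<^sub>R \<i>" by (simp add: complex_eq_iff)
    then show ?thesis by (simp add: add scaleR)
  qed
  then show ?case
    using trig_poly_add[OF trig_poly_scale[OF trig_poly_cos_int[of 1], of "f 1"]
        trig_poly_scale[OF trig_poly_sin_int[of 1], of "f \<i>"]]
    by (simp add: mult.commute)
qed (simp_all add: trig_poly_const trig_poly_add trig_poly_mult)

text \<open>Equal end values let \<open>w\<close> descend to a continuous function on the unit
  circle, where Stone-Weierstrass applies; \<open>cis\<close> pulls the polynomial back to the
  interval.\<close>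

lemma trig_poly_dense:
  fixes w :: "real \<Rightarrow> real"
  assumes w: "continuous_on {0..2*pi} w" "w 0 = w (2*pi)" and "\<epsilon> > 0"
  obtains p where "trig_poly p" "\<And>x. x \<in> {0..2*pi} \<Longrightarrow> \<bar>w x - p x\<bar> < \<epsilon>"
proof -
  define f where "f z = w (Arg2pi z)" for z
  have f: "f (cis x) = w x" if "x \<in> {0..2*pi}" for x
  proof (cases "x = 2 * pi")
    case True
    moreover have "Arg2pi 1 = 0" by (rule Arg2pi_unique[of 1]) auto
    ultimately show ?thesis using w(2) by (simp add: f_def)
  next
    case False
    then have "Arg2pi (cis x) = x"
      using that by (intro Arg2pi_unique[of 1]) (auto simp: cis_conv_exp)
    then show ?thesis by (simp add: f_def)
  qed
  have S: "sphere 0 1 = cis ` {0..2*pi}"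
  proof (intro equalityI subsetI)
    fix z :: complex
    assume "z \<in> sphere 0 1"
    then have "z = cis (Arg2pi z)" using Arg2pi_eq[of z] by (simp add: cis_conv_exp)
    then show "z \<in> cis ` {0..2*pi}"
      using Arg2pi_ge_0[of z] Arg2pi_lt_2pi[of z] by (intro image_eqI) auto
  qed auto
  \<comment> \<open>\<open>Arg2pi\<close> jumps across the positive real axis, so composition does
    not give continuity. Instead \<open>cis\<close>, being continuous on a compact interval, sends
    closed subsets of it to closed sets, and preimages under \<open>f\<close> are such
    images.\<close>
  have "continuous_on (sphere 0 1) f"
    unfolding continuous_on_closed_vimage[OF closed_sphere]
  proof (intro allI impI)
    fix C :: "real set"
    assume "closed C"
    have "f -` C \<inter> sphere 0 1 = cis ` (w -` C \<inter> {0..2*pi})"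
      unfolding S using f by auto
    moreover have "compact (w -` C \<inter> {0..2*pi})"
      using continuous_closed_preimage[OF w(1) _ \<open>closed C\<close>]
      by (auto simp: compact_eq_bounded_closed Int_commute intro: bounded_subset[OF bounded_closed_interval])
    then have "compact (cis ` (w -` C \<inter> {0..2*pi}))"
      by (intro compact_continuous_image continuous_intros)
    ultimately show "closed (f -` C \<inter> sphere 0 1)"
      by (simp only: compact_imp_closed)
  qed
  then obtain g where g: "real_polynomial_function g" "\<And>z. z \<in> sphere 0 1 \<Longrightarrow> \<bar>f z - g z\<bar> < \<epsilon>"
    using Stone_Weierstrass_real_polynomial_function[OF compact_sphere _ \<open>\<epsilon> > 0\<close>] by metis
  show ?thesis
  proof (rule that)
    show "trig_poly (\<lambda>x. g (cis x))" by (rule trig_poly_real_polynomial_cis[OF g(1)])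
    fix x :: real
    assume "x \<in> {0..2*pi}"
    then show "\<bar>w x - g (cis x)\<bar> < \<epsilon>" using g(2)[of "cis x"] f[of x] by simp
  qed
qed

text \<open>
  The bound on \<open>w\<close> is obtained by duality: test \<open>w\<close> against trigonometric polynomials \<open>p\<close>
  close to \<open>w\<close> itself, and move the factors \<open>exp (- s * k\<^sup>2)\<close> from \<open>w0\<close> to \<open>p\<close>.
\<close>

lemma L2_norm_le_of_damped_coefficients:
  fixes w w0 :: "real \<Rightarrow> real"
  assumes w: "continuous_on {0..2*pi} w" "w 0 = w (2*pi)" and w0: "w0 \<in> L2" and "s \<ge> 0"
    and coeff: "\<And>k. (LINT x|Omega. trig k x * w x) = exp (- s * (of_int k)\<^sup>2) * (LINT x|Omega. trig k x * w0 x)"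
    and mean: "(LINT x|Omega. w0 x) = 0"
  shows "L2_norm w \<le> exp (- s) * L2_norm w0"
proof -
  define A where "A = L2_norm w"
  define B where "B = exp (- s) * L2_norm w0"
  \<comment> \<open>The norm of the constant 1; it converts a uniform bound into an
    \<open>L2\<close> bound.\<close>
  define D where "D = sqrt (2 * pi)"
  have nonneg: "A \<ge> 0" "B \<ge> 0" "D \<ge> 0" by (simp_all add: A_def B_def D_def L2_norm_nonneg)
  have wL2: "w \<in> L2" using L2_continuous[OF w(1)] .
  \<comment> \<open>The pairing of \<open>w\<close> with itself splits into that with
    \<open>p\<close>, at most \<open>B * (A + D * \<epsilon>)\<close>, and that with
    \<open>w - p\<close>, at most \<open>D * \<epsilon> * A\<close>.\<close>
  have approx: "A\<^sup>2 \<le> B * A + \<epsilon> * (D * (A + B))" if "\<epsilon> > 0" for \<epsilon>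
  proof -
    obtain p where "trig_poly p" and close: "\<And>x. x \<in> {0..2*pi} \<Longrightarrow> \<bar>w x - p x\<bar> < \<epsilon>"
      using trig_poly_dense[OF w \<open>\<epsilon> > 0\<close>] by blast
    then obtain I \<alpha> where I: "finite I" and p: "p = (\<lambda>x. \<Sum>k\<in>I. \<alpha> k * trig k x)"
      unfolding trig_poly_def by blast
    \<comment> \<open>At frequency 0 the damping factor would be 1 and spoil the bound by
      \<open>exp (- s)\<close>. Replacing it by 0 is harmless because \<open>w0\<close> has mean
      zero; every other frequency satisfies \<open>1 \<le> k\<^sup>2\<close>.\<close>
    define \<beta> where "\<beta> k = (if k = 0 then 0 else \<alpha> k * exp (- s * (of_int k)\<^sup>2))" for k
    define q where "q = (\<lambda>x. \<Sum>k\<in>I. \<beta> k * trig k x)"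
    have cont: "continuous_on {0..2*pi} p" "continuous_on {0..2*pi} q"
      unfolding p q_def by (intro continuous_intros)+
    then have pL2: "p \<in> L2" and qL2: "q \<in> L2" by (simp_all add: L2_continuous)
    have diffL2: "(\<lambda>x. w x - p x) \<in> L2" by (rule L2_diff[OF wL2 pL2])
    have small: "L2_norm (\<lambda>x. w x - p x) \<le> D * \<epsilon>"
      unfolding D_def using diffL2 close \<open>\<epsilon> > 0\<close>
      by (intro L2_norm_bound) (auto simp: L2_def intro: less_imp_le)
    have iw: "integrable Omega (\<lambda>x. trig k x * w x)" and iw0: "integrable Omega (\<lambda>x. trig k x * w0 x)" for k
      using L2_integrable_scaleR[OF trig_L2 wL2] L2_integrable_scaleR[OF trig_L2 w0] by simp_all
    have "(L2_norm q)\<^sup>2 \<le> (\<Sum>k\<in>I. (exp (- s))\<^sup>2 * ((\<alpha> k)\<^sup>2 * (L2_norm (trig k))\<^sup>2))"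
      unfolding q_def L2_norm_trig_sum[OF I]
    proof (intro sum_mono)
      fix k
      have "(\<beta> k)\<^sup>2 \<le> (exp (- s))\<^sup>2 * (\<alpha> k)\<^sup>2"
      proof (cases "k = 0")
        case False
        then have "1 \<le> \<bar>k\<bar>" by linarith
        then have "1 \<le> (of_int k :: real)\<^sup>2"
          by (metis abs_square_le_1 linorder_not_le of_int_1_le_iff of_int_abs order_refl one_le_power power2_abs)
        then have "exp (- s * (of_int k)\<^sup>2) \<le> exp (- s)"
          using \<open>s \<ge> 0\<close> mult_left_mono[of 1 "(of_int k :: real)\<^sup>2" s] by simp
        then have "(exp (- s * (of_int k)\<^sup>2))\<^sup>2 \<le> (exp (- s))\<^sup>2"
          by (intro power_mono) auto
        then have "(exp (- s * (of_int k)\<^sup>2))\<^sup>2 * (\<alpha> k)\<^sup>2 \<le> (exp (- s))\<^sup>2 * (\<alpha> k)\<^sup>2"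
          by (intro mult_right_mono) auto
        moreover have "(\<beta> k)\<^sup>2 = (exp (- s * (of_int k)\<^sup>2))\<^sup>2 * (\<alpha> k)\<^sup>2"
          using False by (simp add: \<beta>_def power_mult_distrib)
        ultimately show ?thesis by (simp only:)
      qed (simp add: \<beta>_def)
      then show "(\<beta> k)\<^sup>2 * (L2_norm (trig k))\<^sup>2 \<le> (exp (- s))\<^sup>2 * ((\<alpha> k)\<^sup>2 * (L2_norm (trig k))\<^sup>2)"
        by (metis mult.assoc mult_right_mono zero_le_power2)
    qed
    also have "\<dots> = (exp (- s) * L2_norm p)\<^sup>2"
      unfolding p power_mult_distrib L2_norm_trig_sum[OF I] by (simp add: sum_distrib_left)
    finally have q_le: "L2_norm q \<le> exp (- s) * L2_norm p"
      by (rule power2_le_imp_le) (simp add: L2_norm_nonneg)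
    have "(LINT x|Omega. p x * w x) = (\<Sum>k\<in>I. \<alpha> k * (LINT x|Omega. trig k x * w x))"
      unfolding p using iw by (simp add: sum_distrib_right mult.assoc)
    also have "\<dots> = (\<Sum>k\<in>I. \<beta> k * (LINT x|Omega. trig k x * w0 x))"
      using mean by (intro sum.cong refl) (auto simp: coeff \<beta>_def)
    also have "\<dots> = (LINT x|Omega. q x * w0 x)"
      unfolding q_def using iw0 by (simp add: sum_distrib_right mult.assoc)
    also have "\<dots> \<le> L2_norm q * L2_norm w0"
      by (rule L2_Cauchy_Schwarz_real[OF qL2 w0])
    also have "\<dots> \<le> (exp (- s) * L2_norm p) * L2_norm w0"
      by (rule mult_right_mono[OF q_le L2_norm_nonneg])
    finally have pw: "(LINT x|Omega. p x * w x) \<le> B * L2_norm p" by (simp add: B_def mult_ac)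
    have "L2_norm p = L2_norm (\<lambda>x. w x + (-1) *\<^sub>R (w x - p x))" by simp
    also have "\<dots> \<le> A + L2_norm (\<lambda>x. (-1) *\<^sub>R (w x - p x))"
      unfolding A_def by (rule L2_norm_triangle[OF wL2 L2_scaleR[OF diffL2]])
    also have "\<dots> \<le> A + D * \<epsilon>" using small by (simp only: L2_norm_scaleR)
    finally have "B * L2_norm p \<le> B * (A + D * \<epsilon>)" using nonneg by (intro mult_left_mono)
    moreover have "(LINT x|Omega. (w x - p x) * w x) \<le> D * \<epsilon> * A"
      using L2_Cauchy_Schwarz_real[OF diffL2 wL2] mult_right_mono[OF small nonneg(1)]
      unfolding A_def by linarith
    moreover have "A\<^sup>2 = (LINT x|Omega. p x * w x) + (LINT x|Omega. (w x - p x) * w x)"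
    proof -
      have "A\<^sup>2 = (LINT x|Omega. p x * w x + (w x - p x) * w x)"
        unfolding A_def L2_norm_square by (simp add: power2_eq_square algebra_simps)
      then show ?thesis
        using L2_integrable_scaleR[OF pL2 wL2] L2_integrable_scaleR[OF diffL2 wL2] by simp
    qed
    ultimately show ?thesis using pw by (simp add: algebra_simps)
  qed
  have "A\<^sup>2 \<le> B * A"
  proof (rule ccontr)
    assume "\<not> A\<^sup>2 \<le> B * A"
    define G where "G = A\<^sup>2 - B * A"
    \<comment> \<open>The summand 1 keeps \<open>F\<close> positive; taking
      \<open>G / (2 * F)\<close> for \<epsilon> then caps the error at half of the gap
      \<open>G\<close>.\<close>
    define F where "F = D * (A + B) + 1"
    have "G > 0" using \<open>\<not> A\<^sup>2 \<le> B * A\<close> by (simp add: G_def)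
    have "F > 0" unfolding F_def using nonneg by (simp add: add_nonneg_pos)
    then have "G / (2 * F) > 0" using \<open>G > 0\<close> by simp
    from approx[OF this] have "G \<le> G / (2 * F) * (D * (A + B))" by (simp add: G_def)
    also have "\<dots> \<le> G / (2 * F) * F"
      using \<open>F > 0\<close> \<open>G > 0\<close> by (intro mult_left_mono) (auto simp: F_def)
    also have "\<dots> = G / 2" using \<open>F > 0\<close> by simp
    finally show False using \<open>G > 0\<close> by simp
  qed
  then have "A \<le> B"
    using nonneg by (cases "A = 0") (auto simp: power2_eq_square)
  then show ?thesis by (simp add: A_def B_def)
qed

section \<open>Passage from real-valued to vector-valued functions\<close>

lemma L2_inner:
  assumes "w \<in> L2"
  shows "(\<lambda>x. w x \<bullet> b) \<in> L2"
proof -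
  have m: "w \<in> borel_measurable Omega" "(\<lambda>x. w x \<bullet> b) \<in> borel_measurable Omega"
    using assms by (auto simp: L2_def)
  have "integrable Omega (\<lambda>x. (norm (w x \<bullet> b))\<^sup>2)"
  proof (rule Bochner_Integration.integrable_bound)
    show "integrable Omega (\<lambda>x. (norm (w x))\<^sup>2 * (norm b)\<^sup>2)"
      using assms by (simp add: L2_def)
    show "AE x in Omega. norm ((norm (w x \<bullet> b))\<^sup>2) \<le> norm ((norm (w x))\<^sup>2 * (norm b)\<^sup>2)"
      using power_mono[OF Cauchy_Schwarz_ineq2, of _ b 2] by (auto simp: power_mult_distrib)
  qed (use m in measurable)
  then show ?thesis using m by (simp add: L2_def)
qed

lemma L2_norm_components:
  assumes "w \<in> L2"
  shows "(L2_norm w)\<^sup>2 = (\<Sum>b\<in>Basis. (L2_norm (\<lambda>x. w x \<bullet> b))\<^sup>2)"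
proof -
  have i: "integrable Omega (\<lambda>x. (norm (w x \<bullet> b))\<^sup>2)" for b
    using L2_inner[OF assms] by (simp add: L2_def)
  have "(L2_norm w)\<^sup>2 = (LINT x|Omega. (\<Sum>b\<in>Basis. (norm (w x \<bullet> b))\<^sup>2))"
    unfolding L2_norm_square
  proof (intro Bochner_Integration.integral_cong refl)
    fix x
    have "w x \<bullet> w x = (\<Sum>b\<in>Basis. (w x \<bullet> b) * (w x \<bullet> b))" by (rule euclidean_inner)
    then show "(norm (w x))\<^sup>2 = (\<Sum>b\<in>Basis. (norm (w x \<bullet> b))\<^sup>2)"
      by (simp only: power2_norm_eq_inner inner_real_def)
  qed
  also have "\<dots> = (\<Sum>b\<in>Basis. (L2_norm (\<lambda>x. w x \<bullet> b))\<^sup>2)"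
    unfolding L2_norm_square using i by (intro Bochner_Integration.integral_sum) auto
  finally show ?thesis .
qed

text \<open>Density of trigonometric polynomials concerns real functions, so the bound is taken on
  each component, with the coefficient identity projected by the inner product with
  \<open>b\<close>; squared norms add up over the basis.\<close>

lemma L2_norm_le_of_damped_coefficients_euclidean:
  fixes w w0 :: "real \<Rightarrow> 'v::euclidean_space"
  assumes w: "continuous_on {0..2*pi} w" "w 0 = w (2*pi)" and w0: "w0 \<in> L2" and "s \<ge> 0"
    and coeff: "\<And>k. (LINT x|Omega. trig k x *\<^sub>R w x) = exp (- s * (of_int k)\<^sup>2) *\<^sub>R (LINT x|Omega. trig k x *\<^sub>R w0 x)"
    and mean: "(LINT x|Omega. w0 x) = 0"
  shows "L2_norm w \<le> exp (- s) * L2_norm w0"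
proof (rule power2_le_imp_le)
  have wL2: "w \<in> L2" using L2_continuous[OF w(1)] .
  have comp: "L2_norm (\<lambda>x. w x \<bullet> b) \<le> exp (- s) * L2_norm (\<lambda>x. w0 x \<bullet> b)" for b
  proof (rule L2_norm_le_of_damped_coefficients[OF _ _ L2_inner[OF w0] \<open>s \<ge> 0\<close>])
    show "continuous_on {0..2*pi} (\<lambda>x. w x \<bullet> b)" by (intro continuous_intros w)
    show "w 0 \<bullet> b = w (2*pi) \<bullet> b" using w by simp
    have i: "integrable Omega (\<lambda>x. trig k x *\<^sub>R w x)" "integrable Omega (\<lambda>x. trig k x *\<^sub>R w0 x)" for k
      by (rule L2_integrable_scaleR[OF trig_L2 wL2] L2_integrable_scaleR[OF trig_L2 w0])+
    show "(LINT x|Omega. trig k x * (w x \<bullet> b)) =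
        exp (- s * (of_int k)\<^sup>2) * (LINT x|Omega. trig k x * (w0 x \<bullet> b))" for k
      using arg_cong[OF coeff[of k], of "\<lambda>v. v \<bullet> b"] i
      by (simp flip: integral_inner_left)
    show "(LINT x|Omega. w0 x \<bullet> b) = 0"
      using arg_cong[OF mean, of "\<lambda>v. v \<bullet> b"] i(2)[of 0] by (simp flip: integral_inner_left)
  qed
  have "(L2_norm w)\<^sup>2 = (\<Sum>b\<in>Basis. (L2_norm (\<lambda>x. w x \<bullet> b))\<^sup>2)"
    by (rule L2_norm_components[OF wL2])
  also have "\<dots> \<le> (\<Sum>b\<in>Basis. (exp (- s) * L2_norm (\<lambda>x. w0 x \<bullet> b))\<^sup>2)"
    by (intro sum_mono power_mono comp L2_norm_nonneg)
  also have "\<dots> = (exp (- s) * L2_norm w0)\<^sup>2"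
    unfolding power_mult_distrib L2_norm_components[OF w0] by (simp add: sum_distrib_left)
  finally show "(L2_norm w)\<^sup>2 \<le> (exp (- s) * L2_norm w0)\<^sup>2" .
qed (simp add: L2_norm_nonneg)

lemma L2_integrable: "w \<in> L2 \<Longrightarrow> integrable Omega w"
  using L2_integrable_scaleR[OF trig_L2[of 0]] by simp

section \<open>The space \<open>H\<^sup>1\<close>\<close>

lemma H1_continuous_on: "w \<in> H1 \<Longrightarrow> continuous_on {0..2*pi} w"
  unfolding H1_def by (blast intro: abs_cont_on_imp_continuous_on)

lemma H1_L2: "w \<in> H1 \<Longrightarrow> w \<in> L2"
  by (intro L2_continuous H1_continuous_on)

lemma H1_Dx_L2: "w \<in> H1 \<Longrightarrow> Dx w \<in> L2"
  by (simp add: H1_def)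

lemma H1_AE_has_vector_derivative:
  assumes "w \<in> H1"
  shows "AE x in Omega. (w has_vector_derivative Dx w x) (at x within {0..2*pi})"
proof -
  have "AE x in Omega. w differentiable (at x within {0..2*pi})" using assms by (simp add: H1_def)
  then show ?thesis
    unfolding Dx_def by eventually_elim (simp add: vector_derivative_works)
qed

text \<open>Integration by parts against \<open>trig k\<close>, whose equal end values leave the
  jump of \<open>w\<close> as the only boundary term.\<close>

lemma H1_trig_coefficient_Dx:
  assumes "w \<in> H1"
  shows "(LINT x|Omega. trig k x *\<^sub>R Dx w x) =
    trig k 0 *\<^sub>R (w (2*pi) - w 0) - of_int k *\<^sub>R (LINT x|Omega. trig (- k) x *\<^sub>R w x)"
proof -
  have ac: "abs_cont_on dist 0 (2*pi) w" using assms by (simp add: H1_def)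
  have i: "integrable Omega (\<lambda>x. trig k x *\<^sub>R Dx w x)" "integrable Omega (\<lambda>x. trig (- k) x *\<^sub>R w x)"
    using assms by (auto intro!: L2_integrable_scaleR trig_L2 H1_L2 H1_Dx_L2)
  have "((\<lambda>x. trig k x *\<^sub>R Dx w x + (of_int k * trig (- k) x) *\<^sub>R w x) has_integral
      trig k (2*pi) *\<^sub>R w (2*pi) - trig k 0 *\<^sub>R w 0) {0..2*pi}"
    using assms by (intro abs_cont_integration_by_parts[OF ac] H1_AE_has_vector_derivative has_derivative_trig
        continuous_intros) auto
  then have "(LINT x|Omega. trig k x *\<^sub>R Dx w x + (of_int k * trig (- k) x) *\<^sub>R w x) =
      trig k (2*pi) *\<^sub>R w (2*pi) - trig k 0 *\<^sub>R w 0"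
    using i by (intro LINT_eq_has_integral) (simp_all flip: scaleR_scaleR)
  then show ?thesis
    using i by (simp add: trig_periodic scaleR_diff_right eq_diff_eq flip: scaleR_scaleR)
qed

text \<open>The difference is an integral of \<open>Dx w\<close>, and Cauchy-Schwarz against the
  constant 1 produces the factor \<open>sqrt (2*pi)\<close>.\<close>

lemma H1_oscillation:
  assumes "w \<in> H1" "x \<in> {0..2*pi}" "y \<in> {0..2*pi}"
  shows "norm (w x - w y) \<le> sqrt (2*pi) * L2_norm (Dx w)"
proof -
  have *: "norm (w v - w u) \<le> sqrt (2*pi) * L2_norm (Dx w)" if "0 \<le> u" "u \<le> v" "v \<le> 2*pi" for u v
  proof -
    have L2: "Dx w \<in> L2" using assms H1_Dx_L2 by blast
    have sub: "{u..v} \<subseteq> {0..2*pi}" using that by auto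
    obtain N where N: "negligible N"
        "\<And>x. x \<in> {0..2*pi} - N \<Longrightarrow> (w has_vector_derivative Dx w x) (at x within {0..2*pi})"
      using AE_lebesgue_on_negligibleE[OF H1_AE_has_vector_derivative[OF assms(1)]] by auto
    have ac: "abs_cont_on dist u v w"
      using abs_cont_on_subset[of dist 0 "2*pi" w u v] assms(1) that by (simp add: H1_def)
    have int: "(Dx w has_integral (w v - w u)) {u..v}"
      using N(2) sub by (intro abs_cont_fundamental_theorem[OF ac \<open>u \<le> v\<close> N(1)])
        (meson Diff_iff has_vector_derivative_within_subset subset_iff)
    have "integrable Omega (\<lambda>x. norm (Dx w x))" using L2_integrable[OF L2] by simp
    then have hi: "((\<lambda>x. norm (Dx w x)) has_integral (LINT x|Omega. norm (Dx w x))) {0..2*pi}"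
      by (intro has_integral_integral_lebesgue_on) auto
    then have io: "(\<lambda>x. norm (Dx w x)) integrable_on {u..v}"
      using integrable_on_subinterval[OF has_integral_integrable sub] by blast
    have "norm (w v - w u) \<le> integral {u..v} (\<lambda>x. norm (Dx w x))"
      using integral_norm_bound_integral[OF has_integral_integrable[OF int] io] integral_unique[OF int] by simp
    also have "\<dots> \<le> integral {0..2*pi} (\<lambda>x. norm (Dx w x))"
      using io hi by (intro integral_subset_le sub) auto
    also have "\<dots> = (LINT x|Omega. 1 * norm (Dx w x))" using integral_unique[OF hi] by simp
    also have "\<dots> \<le> L2_norm (\<lambda>x. 1::real) * L2_norm (\<lambda>x. norm (Dx w x))"
      using trig_L2[of 0] L2 by (intro L2_Cauchy_Schwarz_real L2_norm_mem) (auto simp: trig_def[abs_def])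
    also have "\<dots> \<le> (sqrt (2*pi) * 1) * L2_norm (Dx w)"
      unfolding L2_norm_norm by (intro mult_right_mono L2_norm_bound L2_norm_nonneg) auto
    finally show ?thesis by simp
  qed
  show ?thesis
    using *[of x y] *[of y x] assms(2,3) by (cases "x \<le> y") (auto simp: norm_minus_commute)
qed

text \<open>Differentiation commutes with the difference only almost everywhere, which
  \<open>L2_norm\<close> does not notice; the two resulting triangle inequalities are combined by
  the one in the plane. It will compare a solution at neighbouring times.\<close>

lemma H1_norm_le_add_diff:
  assumes "f \<in> H1" "g \<in> H1"
  shows "H1_norm f \<le> H1_norm g + H1_norm (\<lambda>x. g x - f x)"
proof -
  have "AE x in Omega. x \<in> {0..2*pi}" by (intro AE_I2) simp
  then have "AE x in Omega. Dx g x - Dx f x = Dx (\<lambda>x. g x - f x) x"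
    using H1_AE_has_vector_derivative[OF assms(1)] H1_AE_has_vector_derivative[OF assms(2)]
  proof eventually_elim
    case (elim x)
    have "((\<lambda>x. g x - f x) has_vector_derivative Dx g x - Dx f x) (at x within {0..2*pi})"
      using elim by (intro has_vector_derivative_diff)
    then show ?case
      unfolding Dx_def using elim(1) by (intro vector_derivative_within_closed_interval[symmetric]) auto
  qed
  then have "L2_norm (Dx (\<lambda>x. g x - f x)) = L2_norm (\<lambda>x. Dx g x - Dx f x)"
    by (rule L2_AE_cong(2)[OF L2_diff[OF H1_Dx_L2[OF assms(2)] H1_Dx_L2[OF assms(1)]]])
  then have D: "L2_norm (Dx f) \<le> L2_norm (Dx g) + L2_norm (Dx (\<lambda>x. g x - f x))"
    using L2_norm_triangle[OF H1_Dx_L2[OF assms(2)] L2_diff[OF H1_Dx_L2[OF assms(1)] H1_Dx_L2[OF assms(2)]]]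
    by (simp add: L2_norm_minus_commute[of "Dx f"])
  have "L2_norm f \<le> L2_norm g + L2_norm (\<lambda>x. g x - f x)"
    using L2_norm_triangle[OF H1_L2[OF assms(2)] L2_diff[OF H1_L2[OF assms(1)] H1_L2[OF assms(2)]]]
    by (simp add: L2_norm_minus_commute[of f])
  then have "H1_norm f \<le> sqrt ((L2_norm g + L2_norm (\<lambda>x. g x - f x))\<^sup>2 +
      (L2_norm (Dx g) + L2_norm (Dx (\<lambda>x. g x - f x)))\<^sup>2)"
    unfolding H1_norm_def using D by (intro real_sqrt_le_mono add_mono power_mono L2_norm_nonneg)
  also have "\<dots> \<le> H1_norm g + H1_norm (\<lambda>x. g x - f x)"
    unfolding H1_norm_def by (rule real_sqrt_sum_squares_triangle_ineq)
  finally show ?thesis .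
qed

lemma L2_norm_le_H1_norm: "L2_norm w \<le> H1_norm w" "L2_norm (Dx w) \<le> H1_norm w"
  unfolding H1_norm_def by (simp_all add: real_le_rsqrt)

lemma H1_norm_le: "H1_norm w \<le> L2_norm w + L2_norm (Dx w)"
  unfolding H1_norm_def by (rule sqrt_sum_squares_le_sum) (simp_all add: L2_norm_nonneg)

section \<open>Fourier coefficients of strong solutions\<close>

text \<open>Pairing with \<open>\<phi>\<close> is linear and bounded by
  \<open>L2_norm \<phi>\<close>, so it carries absolute continuity and limits of difference
  quotients over from functions with values in \<open>L2\<close>.\<close>

lemma L2_time_derivative_coefficient:
  fixes f ft :: "real \<Rightarrow> real \<Rightarrow> 'v::euclidean_space"
  assumes f: "has_L2_time_derivative T f ft" and \<phi>: "\<phi> \<in> L2"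
    and L2: "\<And>t. t \<in> {0..T} \<Longrightarrow> f t \<in> L2"
  shows "abs_cont_on dist 0 T (\<lambda>t. LINT x|Omega. \<phi> x *\<^sub>R f t x)"
    and "t \<in> {0..T} \<Longrightarrow> ft t \<in> L2 \<Longrightarrow>
      ((\<lambda>s. L2_norm (\<lambda>x. (f s x - f t x) /\<^sub>R (s - t) - ft t x)) \<longlongrightarrow> 0) (at t within {0..T}) \<Longrightarrow>
      ((\<lambda>t. LINT x|Omega. \<phi> x *\<^sub>R f t x) has_vector_derivative (LINT x|Omega. \<phi> x *\<^sub>R ft t x)) (at t within {0..T})"
proof -
  have int: "integrable Omega (\<lambda>x. \<phi> x *\<^sub>R g x)" if "g \<in> L2" for g :: "real \<Rightarrow> 'v"
    using L2_integrable_scaleR[OF \<phi> that] .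
  show "abs_cont_on dist 0 T (\<lambda>t. LINT x|Omega. \<phi> x *\<^sub>R f t x)"
  proof (rule abs_cont_on_bound[OF _ L2_norm_nonneg order_refl])
    show "abs_cont_on (\<lambda>v w. L2_norm (\<lambda>x. v x - w x)) 0 T f"
      using f by (simp add: has_L2_time_derivative_def)
    fix u v :: real
    assume "0 \<le> u" "u \<le> v" "v \<le> T"
    then have uv: "f u \<in> L2" "f v \<in> L2" using L2 by auto
    have "(LINT x|Omega. \<phi> x *\<^sub>R f u x) - (LINT x|Omega. \<phi> x *\<^sub>R f v x) =
        (LINT x|Omega. \<phi> x *\<^sub>R (f u x - f v x))"
      using int[OF uv(1)] int[OF uv(2)] by (simp add: scaleR_diff_right)
    then show "dist (LINT x|Omega. \<phi> x *\<^sub>R f u x) (LINT x|Omega. \<phi> x *\<^sub>R f v x) \<le>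
        L2_norm \<phi> * L2_norm (\<lambda>x. f u x - f v x) + 0 * (v - u)"
      using L2_Cauchy_Schwarz[OF \<phi> L2_diff[OF uv]] by (simp add: dist_norm)
  qed
  define c where "c t = (LINT x|Omega. \<phi> x *\<^sub>R f t x)" for t
  assume t: "t \<in> {0..T}" "ft t \<in> L2" and
    lim: "((\<lambda>s. L2_norm (\<lambda>x. (f s x - f t x) /\<^sub>R (s - t) - ft t x)) \<longlongrightarrow> 0) (at t within {0..T})"
  define d where "d = (LINT x|Omega. \<phi> x *\<^sub>R ft t x)"
  \<comment> \<open>The left side is the quotient to which \<open>has_derivative_within\<close>
    unfolds; up to the sign of \<open>s - t\<close> it is the difference quotient of
    \<open>c\<close> minus \<open>d\<close>.\<close>
  have quot: "norm ((1 / norm (s - t)) *\<^sub>R (c s - (c t + (s - t) *\<^sub>R d)))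
      \<le> L2_norm \<phi> * L2_norm (\<lambda>x. (f s x - f t x) /\<^sub>R (s - t) - ft t x)"
    if s: "s \<in> {0..T}" "s \<noteq> t" for s
  proof -
    have L: "(\<lambda>x. (f s x - f t x) /\<^sub>R (s - t) - ft t x) \<in> L2"
      by (intro L2_diff L2_scaleR L2 t s)
    have "c s - c t = (LINT x|Omega. \<phi> x *\<^sub>R (f s x - f t x))"
      unfolding c_def using int[OF L2[OF t(1)]] int[OF L2[OF s(1)]] by (simp add: scaleR_diff_right)
    moreover have "(LINT x|Omega. \<phi> x *\<^sub>R ((f s x - f t x) /\<^sub>R (s - t) - ft t x))
        = (LINT x|Omega. (\<phi> x *\<^sub>R (f s x - f t x)) /\<^sub>R (s - t) - \<phi> x *\<^sub>R ft t x)"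
      by (intro Bochner_Integration.integral_cong refl) (simp add: scaleR_diff_right[of _ "_ /\<^sub>R _"] mult.commute)
    ultimately have "(LINT x|Omega. \<phi> x *\<^sub>R ((f s x - f t x) /\<^sub>R (s - t) - ft t x))
        = (c s - c t) /\<^sub>R (s - t) - d"
      unfolding d_def using int[OF t(2)] int[OF L2_diff[OF L2[OF s(1)] L2[OF t(1)]]]
      by (simp del: scaleR_scaleR)
    then have "norm ((c s - c t) /\<^sub>R (s - t) - d)
        \<le> L2_norm \<phi> * L2_norm (\<lambda>x. (f s x - f t x) /\<^sub>R (s - t) - ft t x)"
      using L2_Cauchy_Schwarz[OF \<phi> L] by simp
    moreover have "norm ((1 / norm (s - t)) *\<^sub>R (c s - (c t + (s - t) *\<^sub>R d))) = norm ((c s - c t) /\<^sub>R (s - t) - d)"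
    proof -
      have "(c s - c t) /\<^sub>R (s - t) - d = (c s - (c t + (s - t) *\<^sub>R d)) /\<^sub>R (s - t)"
        using s(2) by (simp add: diff_diff_eq[symmetric] scaleR_diff_right)
      then show ?thesis by (simp add: divide_inverse)
    qed
    ultimately show ?thesis by simp
  qed
  have "((\<lambda>s. (1 / norm (s - t)) *\<^sub>R (c s - (c t + (s - t) *\<^sub>R d))) \<longlongrightarrow> 0) (at t within {0..T})"
  proof (rule Lim_null_comparison)
    show "\<forall>\<^sub>F s in at t within {0..T}. norm ((1 / norm (s - t)) *\<^sub>R (c s - (c t + (s - t) *\<^sub>R d)))
        \<le> L2_norm \<phi> * L2_norm (\<lambda>x. (f s x - f t x) /\<^sub>R (s - t) - ft t x)"
      unfolding eventually_at_filter using quot by (intro always_eventually) blast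
    show "((\<lambda>s. L2_norm \<phi> * L2_norm (\<lambda>x. (f s x - f t x) /\<^sub>R (s - t) - ft t x)) \<longlongrightarrow> 0) (at t within {0..T})"
      using tendsto_mult_right_zero[OF lim] .
  qed
  then have "(c has_vector_derivative d) (at t within {0..T})"
    unfolding has_vector_derivative_def has_derivative_within
    by (simp add: bounded_linear_scaleR_left)
  then show "((\<lambda>t. LINT x|Omega. \<phi> x *\<^sub>R f t x) has_vector_derivative (LINT x|Omega. \<phi> x *\<^sub>R ft t x)) (at t within {0..T})"
    unfolding c_def[abs_def] d_def .
qed

text \<open>No normalising factor: the coefficient at index 0 is \<open>2 * pi\<close> times the
  mean.\<close>

definition fourier_coeff :: "(real \<Rightarrow> 'v::euclidean_space) \<Rightarrow> int \<Rightarrow> 'v" where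
  "fourier_coeff w k = (LINT x|Omega. trig k x *\<^sub>R w x)"

lemma fourier_coeff_Dx:
  assumes "w \<in> H1" "w 0 = w (2*pi)"
  shows "fourier_coeff (Dx w) k = - of_int k *\<^sub>R fourier_coeff w (- k)"
  unfolding fourier_coeff_def using H1_trig_coefficient_Dx[OF assms(1), of k] assms(2) by simp

lemma integral_trig: "(LINT x|Omega. trig k x) = (if k = 0 then 2 * pi else 0)"
  using trig_orthogonal[of k 0] by (simp add: measure_restrict_space)

lemma strong_solution_X_space:
  assumes "strong_solution a K e" "t \<ge> 0"
  shows "e t \<in> X_space"
proof -
  have "e \<in> C_X (t + 1)" using assms unfolding strong_solution_def by force
  then show ?thesis using assms(2) by (auto simp: C_X_def)
qed

lemma strong_solution_H1: "strong_solution a K e \<Longrightarrow> t \<ge> 0 \<Longrightarrow> e t \<in> H1"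
  using strong_solution_X_space[of a K e t] by (simp add: X_space_def)

lemma strong_solution_AE_H2:
  assumes "strong_solution a K e" "T > 0"
  shows "AE t in lebesgue_on {0..T}. Dx (e t) \<in> H1 \<and> Dx (e t) 0 = Dx (e t) (2*pi)"
proof -
  have "e \<in> L2_H2 T" and "AE t in lebesgue_on {0..}. Dx (e t) 0 = Dx (e t) (2*pi)"
    using assms unfolding strong_solution_def by (auto elim: eventually_mono)
  then have "AE t in lebesgue_on {0..T}. e t \<in> H2" "AE t in lebesgue_on {0..T}. Dx (e t) 0 = Dx (e t) (2*pi)"
    using AE_lebesgue_on_subset[where S = "{0..}" and T = "{0..T}"] by (auto simp: L2_H2_def)
  then show ?thesis by eventually_elim (simp add: H2_def)
qed

text \<open>Periodicity of \<open>e t\<close> and of \<open>Dx (e t)\<close> removes the boundary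
  terms in two integrations by parts; each flips the sign of the index, so the original coefficient
  returns. The feedback is constant in space and pairs to zero with every \<open>trig k\<close>
  except \<open>trig 0\<close>.\<close>

lemma strong_solution_fourier_coeff_ode:
  fixes e :: "real \<Rightarrow> real \<Rightarrow> 'v::euclidean_space"
  assumes sol: "strong_solution a K e" and "T > 0"
  shows "abs_cont_on dist 0 T (\<lambda>t. fourier_coeff (e t) k)"
    and "AE t in lebesgue_on {0..T}. ((\<lambda>t. fourier_coeff (e t) k) has_vector_derivative
      - (a * (of_int k)\<^sup>2) *\<^sub>R fourier_coeff (e t) k - (K * (if k = 0 then 2 * pi else 0)) *\<^sub>R e t pi) (at t within {0..T})"
proof -
  obtain et where der: "has_L2_time_derivative T e et"
    and pde: "AE t in lebesgue_on {0..}. AE x in Omega. et t x = a *\<^sub>R Dx (Dx (e t)) x - K *\<^sub>R e t pi"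
    using sol \<open>T > 0\<close> unfolding strong_solution_def by (auto elim: eventually_mono)
  have H1: "e t \<in> H1" "e t 0 = e t (2*pi)" if "t \<in> {0..T}" for t
    using strong_solution_X_space[OF sol, of t] that by (auto simp: X_space_def)
  have L2: "e t \<in> L2" if "t \<in> {0..T}" for t using H1 H1_L2 that by blast
  show "abs_cont_on dist 0 T (\<lambda>t. fourier_coeff (e t) k)"
    unfolding fourier_coeff_def by (rule L2_time_derivative_coefficient(1)[OF der trig_L2 L2])
  have dom: "AE t in lebesgue_on {0..T}. t \<in> {0..T}" by (intro AE_I2) simp
  have "AE t in lebesgue_on {0..T}.
      ((\<lambda>s. L2_norm (\<lambda>x. (e s x - e t x) /\<^sub>R (s - t) - et t x)) \<longlongrightarrow> 0) (at t within {0..T})"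
    using der by (simp add: has_L2_time_derivative_def)
  moreover have "AE t in lebesgue_on {0..T}. AE x in Omega. et t x = a *\<^sub>R Dx (Dx (e t)) x - K *\<^sub>R e t pi"
    by (rule AE_lebesgue_on_subset[OF pde]) auto
  ultimately show "AE t in lebesgue_on {0..T}. ((\<lambda>t. fourier_coeff (e t) k) has_vector_derivative
      - (a * (of_int k)\<^sup>2) *\<^sub>R fourier_coeff (e t) k - (K * (if k = 0 then 2 * pi else 0)) *\<^sub>R e t pi) (at t within {0..T})"
    using strong_solution_AE_H2[OF sol \<open>T > 0\<close>] dom
  proof eventually_elim
    case (elim t)
    define r where "r x = a *\<^sub>R Dx (Dx (e t)) x - K *\<^sub>R e t pi" for x
    have D2: "Dx (Dx (e t)) \<in> L2" using elim(3) H1_Dx_L2 by blast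
    have const: "(\<lambda>x. K *\<^sub>R e t pi) \<in> L2" by (intro L2_continuous continuous_intros)
    have r: "r \<in> L2" unfolding r_def[abs_def] by (intro L2_diff L2_scaleR D2 const)
    have ae: "AE x in Omega. r x = et t x" using elim(2) by eventually_elim (simp add: r_def)
    \<comment> \<open>Square integrability of \<open>et t\<close> is read off from the right-hand
      side of the equation, with no recourse to a jointly measurable representative.\<close>
    have et: "et t \<in> L2" by (rule L2_AE_cong(1)[OF r ae])
    have "(LINT x|Omega. trig k x *\<^sub>R et t x) = (LINT x|Omega. trig k x *\<^sub>R r x)"
    proof (rule integral_cong_AE)
      show "AE x in Omega. trig k x *\<^sub>R et t x = trig k x *\<^sub>R r x"
        using ae by eventually_elim simp
    qed (use L2_integrable_scaleR[OF trig_L2 et] L2_integrable_scaleR[OF trig_L2 r] in auto)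
    also have "\<dots> = (LINT x|Omega. a *\<^sub>R (trig k x *\<^sub>R Dx (Dx (e t)) x) - K *\<^sub>R (trig k x *\<^sub>R e t pi))"
      by (simp add: r_def algebra_simps)
    also have "\<dots> = a *\<^sub>R fourier_coeff (Dx (Dx (e t))) k - K *\<^sub>R ((LINT x|Omega. trig k x) *\<^sub>R e t pi)"
      using L2_integrable_scaleR[OF trig_L2 D2, of k] L2_integrable[OF trig_L2[of k]]
      by (simp add: fourier_coeff_def del: scaleR_scaleR)
    also have "fourier_coeff (Dx (Dx (e t))) k = - ((of_int k)\<^sup>2) *\<^sub>R fourier_coeff (e t) k"
      using fourier_coeff_Dx[of "Dx (e t)" k] fourier_coeff_Dx[OF H1, of t "- k"] elim(3,4)
      by (simp add: power2_eq_square)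
    finally have "(LINT x|Omega. trig k x *\<^sub>R et t x) =
        - (a * (of_int k)\<^sup>2) *\<^sub>R fourier_coeff (e t) k - (K * (if k = 0 then 2 * pi else 0)) *\<^sub>R e t pi"
      by (simp add: integral_trig)
    then show ?case
      using L2_time_derivative_coefficient(2)[OF der trig_L2[of k] L2 elim(4) et elim(1)]
      unfolding fourier_coeff_def by (simp only:)
  qed
qed

section \<open>Decay of the nonzero frequencies, of the gradient and of the mean\<close>

lemma strong_solution_fourier_coeff:
  fixes e :: "real \<Rightarrow> real \<Rightarrow> 'v::euclidean_space"
  assumes sol: "strong_solution a K e" and "T \<ge> 0" and "k \<noteq> 0"
  shows "fourier_coeff (e T) k = exp (- (a * T) * (of_int k)\<^sup>2) *\<^sub>R fourier_coeff (e 0) k"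
proof (cases "T = 0")
  case False
  define \<mu> where "\<mu> = a * (of_int k)\<^sup>2"
  have "T > 0" using False \<open>T \<ge> 0\<close> by simp
  note ode = strong_solution_fourier_coeff_ode[OF sol \<open>T > 0\<close>, of k]
  \<comment> \<open>With the integrating factor the integrand vanishes identically, so the weighted
    coefficient has equal values at 0 and \<open>T\<close>. Absolute continuity makes this hold for
    every \<open>T\<close>.\<close>
  have "((\<lambda>t. exp (\<mu> * t) *\<^sub>R (- \<mu> *\<^sub>R fourier_coeff (e t) k) + (\<mu> * exp (\<mu> * t)) *\<^sub>R fourier_coeff (e t) k)
      has_integral exp (\<mu> * T) *\<^sub>R fourier_coeff (e T) k - exp (\<mu> * 0) *\<^sub>R fourier_coeff (e 0) k) {0..T}"
  proof (rule abs_cont_integration_by_parts[OF ode(1)])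
    show "AE t in lebesgue_on {0..T}.
        ((\<lambda>t. fourier_coeff (e t) k) has_vector_derivative - \<mu> *\<^sub>R fourier_coeff (e t) k) (at t within {0..T})"
      using ode(2) \<open>k \<noteq> 0\<close> by (simp add: \<mu>_def)
    show "((\<lambda>t. exp (\<mu> * t)) has_real_derivative \<mu> * exp (\<mu> * t)) (at t within {0..T})" for t
      by (auto intro!: derivative_eq_intros)
  qed (use \<open>T \<ge> 0\<close> in \<open>auto intro!: continuous_intros\<close>)
  then have "((\<lambda>t. 0) has_integral exp (\<mu> * T) *\<^sub>R fourier_coeff (e T) k - fourier_coeff (e 0) k) {0..T}"
    by (simp add: mult.commute)
  then have "fourier_coeff (e 0) k = exp (\<mu> * T) *\<^sub>R fourier_coeff (e T) k"
    using has_integral_unique[OF has_integral_0] by fastforce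
  then have "exp (- (\<mu> * T)) *\<^sub>R fourier_coeff (e 0) k = fourier_coeff (e T) k"
    by (simp add: exp_minus)
  then show ?thesis by (simp add: \<mu>_def mult_ac)
qed simp

lemma strong_solution_Dx_decay:
  fixes e :: "real \<Rightarrow> real \<Rightarrow> 'v::euclidean_space"
  assumes sol: "strong_solution a K e" and "T > 0" and "a \<ge> 0"
  shows "AE t in lebesgue_on {0..T}. L2_norm (Dx (e t)) \<le> exp (- (a * t)) * L2_norm (Dx (e 0))"
proof -
  have "AE t in lebesgue_on {0..T}. t \<in> {0..T}" by (intro AE_I2) simp
  then show ?thesis using strong_solution_AE_H2[OF sol \<open>T > 0\<close>]
  proof eventually_elim
    case (elim t)
    have Dx: "fourier_coeff (Dx (e s)) k = - of_int k *\<^sub>R fourier_coeff (e s) (- k)" if "s \<ge> 0" for s k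
      using strong_solution_X_space[OF sol that] by (intro fourier_coeff_Dx) (auto simp: X_space_def)
    show ?case
    \<comment> \<open>Continuity and periodicity are available for \<open>Dx (e t)\<close> at almost
      every \<open>t\<close>; of the datum \<open>Dx (e 0)\<close> only membership in
      \<open>L2\<close> and mean zero are asked, and the latter follows from periodicity of
      \<open>e 0\<close>.\<close>
    proof (rule L2_norm_le_of_damped_coefficients_euclidean)
      show "continuous_on {0..2*pi} (Dx (e t))" "Dx (e t) 0 = Dx (e t) (2*pi)"
        using elim(2) H1_continuous_on by auto
      show "Dx (e 0) \<in> L2" using strong_solution_H1[OF sol, of 0] H1_Dx_L2 by simp
      show "0 \<le> a * t" using elim(1) \<open>a \<ge> 0\<close> by simp
      show "(LINT x|Omega. Dx (e 0) x) = 0" using Dx[of 0 0] by (simp add: fourier_coeff_def)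
      show "(LINT x|Omega. trig k x *\<^sub>R Dx (e t) x) =
          exp (- (a * t) * (of_int k)\<^sup>2) *\<^sub>R (LINT x|Omega. trig k x *\<^sub>R Dx (e 0) x)" for k
      proof (cases "k = 0")
        case False
        then have "fourier_coeff (Dx (e t)) k = exp (- (a * t) * (of_int k)\<^sup>2) *\<^sub>R fourier_coeff (Dx (e 0)) k"
          using Dx[of t k] Dx[of 0 k] strong_solution_fourier_coeff[OF sol, of t "- k"] elim(1)
          by (simp add: mult.commute)
        then show ?thesis by (simp only: fourier_coeff_def)
      qed (use Dx[of t 0] Dx[of 0 0] elim(1) in \<open>simp add: fourier_coeff_def\<close>)
    qed
  qed
qed

text \<open>The left side is the norm of the integral of \<open>w x - w y\<close> over
  \<open>x\<close>, and the oscillation bound holds pointwise.\<close>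

lemma H1_mean_deviation:
  fixes w :: "real \<Rightarrow> 'v::euclidean_space"
  assumes "w \<in> H1" "y \<in> {0..2*pi}"
  shows "norm (fourier_coeff w 0 - (2 * pi) *\<^sub>R w y) \<le> 2 * pi * (sqrt (2*pi) * L2_norm (Dx w))"
proof -
  have i: "integrable Omega w" "integrable Omega (\<lambda>x. w y)"
    using L2_integrable[OF H1_L2[OF assms(1)]]
    by (auto intro!: continuous_imp_integrable_real continuous_intros)
  have m: "measure Omega {0..2*pi} = 2 * pi" by (simp add: measure_restrict_space)
  have "fourier_coeff w 0 - (2 * pi) *\<^sub>R w y = (LINT x|Omega. w x - w y)"
    using i by (simp add: fourier_coeff_def m)
  also have "norm \<dots> \<le> (LINT x|Omega. norm (w x - w y))" by (rule integral_norm_bound)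
  also have "\<dots> \<le> (LINT x|Omega. sqrt (2*pi) * L2_norm (Dx w))"
    using i H1_oscillation[OF assms(1) _ assms(2)]
    by (intro integral_mono continuous_imp_integrable_real continuous_intros H1_continuous_on assms) auto
  also have "\<dots> = 2 * pi * (sqrt (2*pi) * L2_norm (Dx w))" by (simp add: m)
  finally show ?thesis .
qed

text \<open>
  The mean obeys \<open>m' = - K * e(\<pi>)\<close>, and \<open>e(\<pi>)\<close> differs from the mean by a quantity that decays
  like \<open>exp (- a * t)\<close>. Integrating \<open>(exp (K * t) * m)'\<close> needs \<open>a > K\<close>.
\<close>

lemma strong_solution_mean_decay:
  fixes e :: "real \<Rightarrow> real \<Rightarrow> 'v::euclidean_space"
  assumes sol: "strong_solution a K e" and "T \<ge> 0" and "K > 0" "a > K"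
  shows "norm (fourier_coeff (e T) 0) \<le> exp (- (K * T)) *
    (norm (fourier_coeff (e 0) 0) + K * (2 * pi * (sqrt (2*pi) * L2_norm (Dx (e 0)))) / (a - K))"
proof (cases "T = 0")
  case True
  then show ?thesis using assms by (simp add: L2_norm_nonneg)
next
  case False
  then have "T > 0" using \<open>T \<ge> 0\<close> by simp
  define M where "M = K * (2 * pi * (sqrt (2*pi) * L2_norm (Dx (e 0))))"
  have "M \<ge> 0" unfolding M_def using \<open>K > 0\<close> by (simp add: L2_norm_nonneg)
  obtain N where N: "negligible N"
      "\<And>t. t \<in> {0..T} - N \<Longrightarrow> L2_norm (Dx (e t)) \<le> exp (- (a * t)) * L2_norm (Dx (e 0))"
    using AE_lebesgue_on_negligibleE[OF strong_solution_Dx_decay[OF sol \<open>T > 0\<close>]] assms(3,4) by auto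
  have NAE: "AE t in lebesgue_on {0..T}. t \<notin> N"
    using N(1) by (subst AE_restrict_space_iff) (auto simp: negligible_iff_null_sets intro: AE_not_in eventually_mono)
  define m where "m t = fourier_coeff (e t) 0" for t
  \<comment> \<open>On the null set \<open>N\<close> the derivative is redefined so that the
    integrand below vanishes there: the comparison of integrals asks for its bound at every time,
    while the decay of the gradient fails to be known on \<open>N\<close>.\<close>
  define m' where "m' t = (if t \<in> N then - K *\<^sub>R m t else - (K * (2 * pi)) *\<^sub>R e t pi)" for t
  note ode = strong_solution_fourier_coeff_ode[OF sol \<open>T > 0\<close>, of 0]
  have int: "((\<lambda>t. exp (K * t) *\<^sub>R m' t + (K * exp (K * t)) *\<^sub>R m t)
      has_integral exp (K * T) *\<^sub>R m T - exp (K * 0) *\<^sub>R m 0) {0..T}"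
  proof (rule abs_cont_integration_by_parts)
    show "abs_cont_on dist 0 T m" using ode(1) by (simp add: m_def[abs_def])
    show "AE t in lebesgue_on {0..T}. (m has_vector_derivative m' t) (at t within {0..T})"
      using ode(2) NAE by eventually_elim (simp add: m_def[abs_def] m'_def)
    show "((\<lambda>t. exp (K * t)) has_real_derivative K * exp (K * t)) (at t within {0..T})" for t
      by (auto intro!: derivative_eq_intros)
  qed (use \<open>T \<ge> 0\<close> in \<open>auto intro!: continuous_intros\<close>)
  have bound: "norm (exp (K * t) *\<^sub>R m' t + (K * exp (K * t)) *\<^sub>R m t) \<le> M * exp ((K - a) * t)"
    if "t \<in> {0..T}" for t
  proof (cases "t \<in> N")
    case True
    then show ?thesis using \<open>M \<ge> 0\<close> by (simp add: m'_def mult.commute)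
  next
    case False
    have "exp (K * t) *\<^sub>R m' t + (K * exp (K * t)) *\<^sub>R m t =
        (K * exp (K * t)) *\<^sub>R (fourier_coeff (e t) 0 - (2 * pi) *\<^sub>R e t pi)"
      using False by (simp add: m'_def m_def scaleR_diff_right mult_ac)
    then have "norm (exp (K * t) *\<^sub>R m' t + (K * exp (K * t)) *\<^sub>R m t) =
        K * exp (K * t) * norm (fourier_coeff (e t) 0 - (2 * pi) *\<^sub>R e t pi)"
      using \<open>K > 0\<close> by simp
    also have "\<dots> \<le> K * exp (K * t) * (2 * pi * (sqrt (2*pi) * L2_norm (Dx (e t))))"
      using \<open>K > 0\<close> that by (intro mult_left_mono H1_mean_deviation strong_solution_H1[OF sol]) auto
    also have "\<dots> \<le> K * exp (K * t) * (2 * pi * (sqrt (2*pi) * (exp (- (a * t)) * L2_norm (Dx (e 0)))))"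
      using \<open>K > 0\<close> N(2)[of t] that False by (intro mult_left_mono) auto
    also have "\<dots> = M * (exp (K * t) * exp (- (a * t)))" by (simp add: M_def mult_ac)
    also have "\<dots> = M * exp ((K - a) * t)" by (simp add: left_diff_distrib flip: exp_add)
    finally show ?thesis .
  qed
  \<comment> \<open>Because \<open>K - a\<close> is negative, this integral stays below
    \<open>M / (a - K)\<close> for every \<open>T\<close>, which is the second term of the
    bound.\<close>
  have hi: "((\<lambda>t. M * exp ((K - a) * t)) has_integral
      M * exp ((K - a) * T) / (K - a) - M * exp ((K - a) * 0) / (K - a)) {0..T}"
    using \<open>T \<ge> 0\<close> \<open>a > K\<close> by (intro fundamental_theorem_of_calculus)
      (auto simp flip: has_real_derivative_iff_has_vector_derivative intro!: derivative_eq_intros)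
  have "norm (exp (K * T) *\<^sub>R m T - m 0) \<le> M * exp ((K - a) * T) / (K - a) - M / (K - a)"
    using integral_norm_bound_integral[OF has_integral_integrable[OF int] has_integral_integrable[OF hi] bound]
      integral_unique[OF int] integral_unique[OF hi] by simp
  also have "\<dots> = M / (a - K) - M * exp ((K - a) * T) / (a - K)"
    using \<open>a > K\<close> by (simp add: field_simps)
  also have "\<dots> \<le> M / (a - K)" using \<open>M \<ge> 0\<close> \<open>a > K\<close> by simp
  finally have "norm (exp (K * T) *\<^sub>R m T) \<le> norm (m 0) + M / (a - K)"
    using norm_triangle_ineq2[of "exp (K * T) *\<^sub>R m T" "m 0"] by linarith
  then have "exp (- (K * T)) * (exp (K * T) * norm (m T)) \<le> exp (- (K * T)) * (norm (m 0) + M / (a - K))"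
    by (intro mult_left_mono) auto
  moreover have "exp (- (K * T)) * (exp (K * T) * norm (m T)) = norm (m T)"
    by (simp add: exp_minus)
  ultimately show ?thesis by (simp only: m_def M_def)
qed

section \<open>From almost every time to every time, and the constant\<close>

lemma strong_solution_AE_imp_all:
  fixes e :: "real \<Rightarrow> real \<Rightarrow> 'v::euclidean_space"
  assumes sol: "strong_solution a K e" and "t \<ge> 0" and g: "continuous_on UNIV g"
    and ae: "\<And>T. T > 0 \<Longrightarrow> AE s in lebesgue_on {0..T}. H1_norm (e s) \<le> g s"
  shows "H1_norm (e t) \<le> g t"
proof -
  \<comment> \<open>One unit beyond \<open>t\<close> leaves room to approach \<open>t\<close> from
    the right, also at \<open>t = 0\<close>.\<close>
  define T where "T = t + 1"
  have "T > 0" "t \<in> {0..T}" using \<open>t \<ge> 0\<close> by (auto simp: T_def)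
  obtain N where N: "negligible N" "\<And>s. s \<in> {0..T} - N \<Longrightarrow> H1_norm (e s) \<le> g s"
    using AE_lebesgue_on_negligibleE[OF ae[OF \<open>T > 0\<close>]] by auto
  define F where "F = at t within ({0..T} - N)"
  \<comment> \<open>A gap in the good times near \<open>t\<close> would put a nonempty open interval
    inside \<open>N\<close>; the length bound 1 keeps that interval inside
    \<open>{0..T}\<close>.\<close>
  have "t islimpt ({0..T} - N)"
    unfolding islimpt_approachable
  proof (intro allI impI, rule ccontr)
    fix \<epsilon> :: real
    assume "\<epsilon> > 0" and none: "\<not> (\<exists>s\<in>{0..T} - N. s \<noteq> t \<and> dist s t < \<epsilon>)"
    have "{t<..<t + min \<epsilon> 1} \<subseteq> N"
    proof
      fix s
      assume "s \<in> {t<..<t + min \<epsilon> 1}"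
      then show "s \<in> N" using none \<open>t \<ge> 0\<close> by (auto simp: T_def dist_real_def)
    qed
    then have "negligible {t<..<t + min \<epsilon> 1}" using N(1) negligible_subset by blast
    then show False
      using open_not_negligible[of "{t<..<t + min \<epsilon> 1}"] \<open>\<epsilon> > 0\<close> by simp
  qed
  then have "F \<noteq> bot" by (simp add: F_def trivial_limit_within)
  \<comment> \<open>The bound at a good time \<open>s\<close> passes to \<open>t\<close> up to the
    \<open>H1_norm\<close> of the difference, which tends to zero by continuity into
    \<open>X_space\<close>.\<close>
  moreover have "((\<lambda>s. g s + H1_norm (\<lambda>x. e s x - e t x)) \<longlongrightarrow> g t + 0) F"
  proof (rule tendsto_add)
    show "(g \<longlongrightarrow> g t) F"
      using g unfolding F_def continuous_on_def by (meson UNIV_I subset_UNIV tendsto_within_subset)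
    have "e \<in> C_X T" using sol \<open>T > 0\<close> unfolding strong_solution_def by blast
    then have "((\<lambda>s. H1_norm (\<lambda>x. e s x - e t x)) \<longlongrightarrow> 0) (at t within {0..T})"
      using \<open>t \<in> {0..T}\<close> by (simp add: C_X_def)
    then show "((\<lambda>s. H1_norm (\<lambda>x. e s x - e t x)) \<longlongrightarrow> 0) F"
      unfolding F_def by (rule tendsto_within_subset) auto
  qed
  moreover have "\<forall>\<^sub>F s in F. H1_norm (e t) \<le> g s + H1_norm (\<lambda>x. e s x - e t x)"
    unfolding F_def eventually_at_filter
  proof (intro always_eventually allI impI)
    fix s
    assume "s \<in> {0..T} - N"
    then show "H1_norm (e t) \<le> g s + H1_norm (\<lambda>x. e s x - e t x)"
      using N(2)[of s] H1_norm_le_add_diff[OF strong_solution_H1[OF sol \<open>t \<ge> 0\<close>] strong_solution_H1[OF sol, of s]]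
      by auto
  qed
  ultimately show ?thesis using tendsto_lowerbound by fastforce
qed

text \<open>Source of the constant, relative to \<open>exp (- \<delta> * t) * H1_norm (e 0)\<close>:
  the mean decay bounds the coefficient at 0 by \<open>D + K * (2 * pi * D) / (a - K)\<close>;
  division by \<open>2 * pi\<close> gives the mean itself, the deviation from it adds
  \<open>D\<close>, the outer \<open>D\<close> turns this uniform bound into an \<open>L2\<close>
  bound, and the final 1 accounts for \<open>Dx (e t)\<close>.\<close>

lemma strong_solution_H1_bound:
  fixes e :: "real \<Rightarrow> real \<Rightarrow> 'v::euclidean_space"
  assumes sol: "strong_solution a K e" and "K > 0" "a > K" "\<delta> \<le> K"
    and "t \<ge> 0" and Dx: "L2_norm (Dx (e t)) \<le> exp (- (a * t)) * L2_norm (Dx (e 0))"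
    and D: "D = sqrt (2*pi)"
  shows "H1_norm (e t) \<le>
    (D * (D + (D + K * (2 * pi * D) / (a - K)) / (2 * pi)) + 1) * exp (- \<delta> * t) * H1_norm (e 0)"
proof -
  define H where "H = H1_norm (e 0)"
  define E where "E = exp (- \<delta> * t)"
  define m where "m = norm (fourier_coeff (e t) 0)"
  define M where "M = D + K * (2 * pi * D) / (a - K)"
  have "D \<ge> 0" by (simp add: D)
  have "H \<ge> 0" unfolding H_def H1_norm_def by simp
  have "M \<ge> 0" unfolding M_def using \<open>D \<ge> 0\<close> assms(2,3) by simp
  have E: "exp (- (a * t)) \<le> E" "exp (- (K * t)) \<le> E"
    unfolding E_def using assms(3,4,5) by (auto intro: mult_right_mono)
  have L2: "e 0 \<in> L2" using H1_L2 strong_solution_H1[OF sol, of 0] by simp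
  have H: "L2_norm (e 0) \<le> H" "L2_norm (Dx (e 0)) \<le> H"
    unfolding H_def by (rule L2_norm_le_H1_norm)+
  have "norm (fourier_coeff (e 0) 0) \<le> L2_norm (trig 0) * L2_norm (e 0)"
    unfolding fourier_coeff_def by (rule L2_Cauchy_Schwarz[OF trig_L2 L2])
  also have "\<dots> \<le> (D * 1) * H"
    unfolding D using H trig_L2[of 0] by (intro mult_mono L2_norm_bound) (auto simp: L2_def L2_norm_nonneg)
  finally have c0: "norm (fourier_coeff (e 0) 0) \<le> D * H" by simp
  have w: "L2_norm (Dx (e t)) \<le> E * H"
    using Dx mult_mono[OF E(1) H(2)] by (simp add: E_def L2_norm_nonneg)
  have "m \<le> exp (- (K * t)) * (norm (fourier_coeff (e 0) 0) + K * (2 * pi * (D * L2_norm (Dx (e 0)))) / (a - K))"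
    unfolding m_def D by (rule strong_solution_mean_decay[OF sol \<open>t \<ge> 0\<close> assms(2,3)])
  also have "\<dots> \<le> E * (D * H + K * (2 * pi * (D * H)) / (a - K))"
    using E c0 H \<open>D \<ge> 0\<close> assms(2,3)
    by (intro mult_mono add_mono divide_right_mono mult_left_mono) (auto simp: E_def L2_norm_nonneg)
  also have "\<dots> = E * (M * H)" by (simp add: M_def algebra_simps)
  finally have m: "m \<le> E * (M * H)" .
  have sup: "norm (e t y) \<le> (D + M / (2 * pi)) * (E * H)" if "y \<in> {0..2*pi}" for y
  proof -
    have "2 * pi * norm (e t y) = norm ((2 * pi) *\<^sub>R e t y)" by simp
    also have "\<dots> \<le> m + norm (fourier_coeff (e t) 0 - (2 * pi) *\<^sub>R e t y)"
      unfolding m_def using norm_triangle_ineq4[of "fourier_coeff (e t) 0" "fourier_coeff (e t) 0 - (2 * pi) *\<^sub>R e t y"] by simp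
    also have "\<dots> \<le> E * (M * H) + 2 * pi * (D * L2_norm (Dx (e t)))"
      unfolding D by (intro add_mono m[unfolded D] H1_mean_deviation strong_solution_H1[OF sol \<open>t \<ge> 0\<close>] that)
    also have "\<dots> \<le> E * (M * H) + 2 * pi * (D * (E * H))"
      using w \<open>D \<ge> 0\<close> by (intro add_left_mono mult_left_mono) auto
    also have "\<dots> = 2 * pi * ((D + M / (2 * pi)) * (E * H))" by (simp add: field_simps)
    finally show ?thesis by simp
  qed
  have "L2_norm (e t) \<le> D * ((D + M / (2 * pi)) * (E * H))"
    unfolding D
  proof (rule L2_norm_bound)
    show "e t \<in> borel_measurable Omega"
      using H1_L2[OF strong_solution_H1[OF sol \<open>t \<ge> 0\<close>]] by (simp add: L2_def)
    show "0 \<le> (sqrt (2*pi) + M / (2 * pi)) * (E * H)"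
      using \<open>M \<ge> 0\<close> \<open>H \<ge> 0\<close> by (simp add: E_def)
  qed (use sup D in auto)
  then have "H1_norm (e t) \<le> D * ((D + M / (2 * pi)) * (E * H)) + E * H"
    using H1_norm_le[of "e t"] w by linarith
  then show ?thesis by (simp add: M_def E_def H_def algebra_simps)
qed

theorem theorem3:
  fixes \<delta> K a :: real
  assumes "\<delta> > 0" and "K > \<delta>" and "a \<ge> K\<^sup>2 / (K - \<delta>)"
  shows "\<exists>C>0. \<forall>e :: real \<Rightarrow> real \<Rightarrow> real ^ 3.
    strong_solution a K e \<and> e 0 \<in> X_space \<longrightarrow>
      (\<forall>t\<ge>0. H1_norm (e t) \<le> C * exp (- \<delta> * t) * H1_norm (e 0))"
proof -
  have "K > 0" using assms by simp
  \<comment> \<open>The threshold for \<open>a\<close> is \<open>K\<close> times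
    \<open>K / (K - \<delta>)\<close>, a factor greater than 1.\<close>
  have "K * (K - \<delta>) < K\<^sup>2" using assms by (simp add: power2_eq_square)
  then have "K < K\<^sup>2 / (K - \<delta>)" using assms by (simp add: field_simps)
  then have "a > K" using assms by simp
  define D where "D = sqrt (2*pi)"
  define C where "C = D * (D + (D + K * (2 * pi * D) / (a - K)) / (2 * pi)) + 1"
  have "C > 0"
    unfolding C_def using \<open>K > 0\<close> \<open>a > K\<close>
    by (intro add_nonneg_pos mult_nonneg_nonneg add_nonneg_nonneg divide_nonneg_nonneg) (auto simp: D_def)
  moreover have "H1_norm (e t) \<le> C * exp (- \<delta> * t) * H1_norm (e 0)"
    if sol: "strong_solution a K e" and "t \<ge> 0" for e :: "real \<Rightarrow> real \<Rightarrow> real ^ 3" and t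
  proof (rule strong_solution_AE_imp_all[OF sol \<open>t \<ge> 0\<close>])
    fix T :: real
    assume "T > 0"
    have "AE s in lebesgue_on {0..T}. s \<in> {0..T}" by (intro AE_I2) simp
    moreover have "AE s in lebesgue_on {0..T}. L2_norm (Dx (e s)) \<le> exp (- (a * s)) * L2_norm (Dx (e 0))"
      using \<open>K > 0\<close> \<open>a > K\<close> by (intro strong_solution_Dx_decay[OF sol \<open>T > 0\<close>]) simp
    ultimately show "AE s in lebesgue_on {0..T}. H1_norm (e s) \<le> C * exp (- \<delta> * s) * H1_norm (e 0)"
      unfolding C_def
      by eventually_elim (use assms \<open>K > 0\<close> \<open>a > K\<close> in \<open>intro strong_solution_H1_bound[OF sol _ _ _ _ _ D_def]; simp\<close>)
  qed (intro continuous_intros)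
  ultimately show ?thesis by blast
qed

end
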